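(* Let $f:\mathbb{R}^n\to\mathbb{R}$ and $G:\mathbb{R}^n\to\mathbb{S}^m$ be continuously differentiable. Let $\{\rho_k\}_{k\in\mathbb{N}}$ be a sequence of positive reals with $\rho_k\to\infty$, and let $\{x^k\}_{k\in\mathbb{N}}\subset\mathbb{R}^n$ converge to a point $\bar x\in\mathcal{F}$, such that $$\nabla_x L\left(x^k,\rho_k\,\Pi_{\mathbb{S}^m_+}(-G(x^k))\right)\to 0 .$$ If $\bar x$ satisfies weak-CPLD, then $\bar x$ satisfies the KKT conditions. In particular, every local minimizer of the problem of minimizing $f(x)$ subject to $G(x)\succeq 0$ that satisfies weak-CPLD also satisfies the KKT conditions.
   Context: $\mathbb{S}^m$ is the space of real symmetric $m\times m$ matrices with inner product $\langle M,N\rangle=\mathrm{trace}(MN)$ and Frobenius norm; $\mathbb{S}^m_+$ is the cone of positive semidefinite matrices; $M\succeq 0$ means $M\in\mathbb{S}^m_+$; $\Pi_{\mathbb{S}^m_+}$ is the orthogonal projection onto $\mathbb{S}^m_+$. The problem is: minimize $f(x)$ over $x\in\mathbb{R}^n$ subject to $G(x)\succeq0$; $\mathcal{F}=\{x: G(x)\succeq 0\}$. $DG(x)$ is the derivative of $G$, $DG(x)^*$ its adjoint, $D_{x_i}G(x)$ the $i$-th partial derivative. $L(x,Y)=f(x)-\langle G(x),Y\rangle$, so $\nabla_xL(x,Y)=\nabla f(x)-DG(x)^*[Y]$. KKT conditions at $\bar x\in\mathcal{F}$: there exists $\bar Y\succeq0$ with $\nabla_xL(\bar x,\bar Y)=0$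 and $\langle G(\bar x),\bar Y\rangle=0$. Eigenvalues of $M\in\mathbb{S}^m$ are ordered $\lambda_1(M)\ge\dots\ge\lambda_m(M)$. For $0\le r<m$, $\mathcal{E}_r(M)$ is the set of $E\in\mathbb{R}^{m\times(m-r)}$ with $E^\top E=I_{m-r}$ and $ME=E\,\mathrm{Diag}(\lambda_{r+1}(M),\dots,\lambda_m(M))$. For $E$ with columns $e_1,\dots,e_{m-r}$, $v_{ii}(x,E)=[e_i^\top D_{x_1}G(x)e_i,\dots,e_i^\top D_{x_n}G(x)e_i]^\top\in\mathbb{R}^n$. A finite family $\{z_i\}_{i\in J}$ is positively linearly dependent if there are $\alpha_i\ge0$, $i \in J$, not all zero, with $\sum_{i\in J}\alpha_iz_i=0$. Weak-CPLD at $\bar x\in\mathcal{F}$, with $r=\mathrm{rank}\,G(\bar x)$: either $r=m$ or, for each sequence $x^k\to\bar x$, there exist an infinite set $I\subseteq\mathbb{N}$ and matrices $E^k\in\mathcal{E}_r(G(x^k))$, $k\in I$, with $\{E^k\}_{k\in I}$ convergent to some $\bar E$, such that for every $J\subseteq\{1,\dots,m-r\}$: if $\{v_{ii}(\bar x,\bar E)\}_{i\in J}$ is positively linearly dependent, then $\{v_{ii}(x^k,E^k)\}_{i\in J}$ is linearly dependent for all sufficiently large $k\in I$. *)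

theory Defs
  imports "HOL-Analysis.Analysis" "HOL-Computational_Algebra.Polynomial"
begin

section \<open>Symmetric matrices\<close>

definition sym_mats :: "(real ^ 'm ^ 'm) set" where
  "sym_mats = {M. transpose M = M}"

definition psd_cone :: "(real ^ 'm ^ 'm) set" where
  "psd_cone = {M \<in> sym_mats. \<forall>v. 0 \<le> v \<bullet> (M *v v)}"

text \<open>
  The inner product $\mathrm{trace}(MN)$ of symmetric matrices. On \<^const>\<open>sym_mats\<close> it coincides
  with the library inner product of \<^typ>\<open>real ^ 'm ^ 'm\<close>, so the library norm and distance, and
  hence \<^const>\<open>closest_point\<close>, are those of the Frobenius norm.
\<close>

definition mat_inner :: "real ^ 'm ^ 'm \<Rightarrow> real ^ 'm ^ 'm \<Rightarrow> real" where
  "mat_inner M N = trace (M ** N)"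

lemma mat_inner_eq_inner:
  assumes "N \<in> sym_mats"
  shows "mat_inner M N = M \<bullet> N"
proof -
  have "N $ j $ i = N $ i $ j" for i j
    using assms by (metis (mono_tags, lifting) mem_Collect_eq sym_mats_def transpose_def vec_lambda_beta)
  then show ?thesis
    by (simp add: mat_inner_def trace_def matrix_matrix_mult_def inner_vec_def)
qed

definition proj_psd :: "real ^ 'm ^ 'm \<Rightarrow> real ^ 'm ^ 'm" where
  "proj_psd = closest_point psd_cone"

definition charpoly :: "real ^ 'm ^ 'm \<Rightarrow> real poly" where
  "charpoly M = det (\<chi> i j. (if i = j then [:0, 1:] else 0) - [:M $ i $ j:])"

lemma poly_charpoly: "poly (charpoly M) t = det (mat t - M)"
  unfolding charpoly_def det_def poly_sum poly_mult poly_prod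
  by (intro sum.cong arg_cong2[where f = "(*)"] prod.cong refl) (auto simp: mat_def of_int_poly)

text \<open>
  \<open>eigval M i\<close>, for \<open>1 \<le> i \<le> CARD('m)\<close>, is the \<open>i\<close>-th largest eigenvalue of a symmetric \<open>M\<close>,
  eigenvalues being counted with multiplicity.
\<close>

definition eigval :: "real ^ 'm ^ 'm \<Rightarrow> nat \<Rightarrow> real" where
  "eigval M i = rev (sorted_list_of_multiset (proots (charpoly M))) ! (i - 1)"

text \<open>
  Since \<open>r\<close> varies, an $m \times (m-r)$ matrix \<open>E\<close> is represented by its columns \<open>E i\<close>,
  \<open>i \<in> {1..CARD('m) - r}\<close>; values of \<open>E\<close> at other indices are irrelevant. The two conditions are
  $E^\top E = I_{m-r}$ and $ME = E\,\mathrm{Diag}(\lambda_{r+1}(M),\dots,\lambda_m(M))$, read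
  entrywise and columnwise.
\<close>

definition eigvec_mats :: "nat \<Rightarrow> real ^ 'm ^ 'm \<Rightarrow> (nat \<Rightarrow> real ^ 'm) set" where
  "eigvec_mats r M = {E.
     (\<forall>i\<in>{1..CARD('m) - r}. \<forall>j\<in>{1..CARD('m) - r}. E i \<bullet> E j = (if i = j then 1 else 0)) \<and>
     (\<forall>i\<in>{1..CARD('m) - r}. M *v E i = eigval M (r + i) *\<^sub>R E i)}"


section \<open>Derivatives\<close>

definition C1 :: "('a::euclidean_space \<Rightarrow> 'b::euclidean_space) \<Rightarrow> bool" where
  "C1 f \<longleftrightarrow> (\<exists>f' :: 'a \<Rightarrow> 'a \<Rightarrow>\<^sub>L 'b.
     (\<forall>x. (f has_derivative blinfun_apply (f' x)) (at x)) \<and> continuous_on UNIV f')"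

definition gradient :: "('a::euclidean_space \<Rightarrow> real) \<Rightarrow> 'a \<Rightarrow> 'a" where
  "gradient f x = (THE D. GDERIV f x :> D)"

lemma gradient_eqI:
  assumes "GDERIV f x :> D"
  shows "gradient f x = D"
  unfolding gradient_def
proof (rule the_equality)
  show "GDERIV f x :> D" by (fact assms)
next
  fix D' assume "GDERIV f x :> D'"
  then have "(\<lambda>h. h \<bullet> D') = (\<lambda>h. h \<bullet> D)"
    using assms has_derivative_unique unfolding gderiv_def by blast
  then show "D' = D"
    by (metis vector_eq_ldot)
qed

definition partial_deriv :: "(real ^ 'n \<Rightarrow> 'b::real_normed_vector) \<Rightarrow> 'n \<Rightarrow> real ^ 'n \<Rightarrow> 'b" where
  "partial_deriv G i x = frechet_derivative G (at x) (axis i 1)"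

definition diag_vec :: "(real ^ 'n \<Rightarrow> real ^ 'm ^ 'm) \<Rightarrow> real ^ 'n \<Rightarrow> (nat \<Rightarrow> real ^ 'm) \<Rightarrow> nat \<Rightarrow> real ^ 'n" where
  "diag_vec G x E i = (\<chi> l. E i \<bullet> (partial_deriv G l x *v E i))"


section \<open>The optimization problem\<close>

definition feasible :: "(real ^ 'n \<Rightarrow> real ^ 'm ^ 'm) \<Rightarrow> (real ^ 'n) set" where
  "feasible G = {x. G x \<in> psd_cone}"

definition local_minimizer :: "('a::metric_space \<Rightarrow> real) \<Rightarrow> 'a set \<Rightarrow> 'a \<Rightarrow> bool" where
  "local_minimizer f S x \<longleftrightarrow> x \<in> S \<and> (\<exists>e>0. \<forall>y \<in> S \<inter> ball x e. f x \<le> f y)"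

definition lagrangian ::
  "(real ^ 'n \<Rightarrow> real) \<Rightarrow> (real ^ 'n \<Rightarrow> real ^ 'm ^ 'm) \<Rightarrow> real ^ 'n \<Rightarrow> real ^ 'm ^ 'm \<Rightarrow> real" where
  "lagrangian f G x Y = f x - mat_inner (G x) Y"

definition grad_lagrangian ::
  "(real ^ 'n \<Rightarrow> real) \<Rightarrow> (real ^ 'n \<Rightarrow> real ^ 'm ^ 'm) \<Rightarrow> real ^ 'n \<Rightarrow> real ^ 'm ^ 'm \<Rightarrow> real ^ 'n" where
  "grad_lagrangian f G x Y = gradient (\<lambda>z. lagrangian f G z Y) x"

lemma grad_lagrangian_eq:
  assumes "f differentiable at x" "G differentiable at x" "Y \<in> sym_mats"
  shows "grad_lagrangian f G x Y = gradient f x - adjoint (frechet_derivative G (at x)) Y"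
proof -
  let ?f' = "frechet_derivative f (at x)" and ?G' = "frechet_derivative G (at x)"
  have f': "(f has_derivative ?f') (at x)" and G': "(G has_derivative ?G') (at x)"
    using assms frechet_derivative_works by blast+
  then have lin: "linear ?f'" "linear ?G'"
    using has_derivative_linear by blast+
  have "?f' h = h \<bullet> adjoint ?f' 1" for h
    using adjoint_works[OF lin(1), of h 1] by simp
  then have "?f' = (\<lambda>h. h \<bullet> adjoint ?f' 1)" by blast
  then have F: "GDERIV f x :> adjoint ?f' 1"
    using f' unfolding gderiv_def by simp
  have "((\<lambda>z. G z \<bullet> Y) has_derivative (\<lambda>h. ?G' h \<bullet> Y)) (at x)"
    by (intro has_derivative_inner_left G')
  moreover have "(\<lambda>h. ?G' h \<bullet> Y) = (\<lambda>h. h \<bullet> adjoint ?G' Y)"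
    using adjoint_works[OF lin(2)] by simp
  ultimately have "GDERIV (\<lambda>z. G z \<bullet> Y) x :> adjoint ?G' Y"
    unfolding gderiv_def by simp
  from GDERIV_diff[OF F this] show ?thesis
    using gradient_eqI[OF F] gradient_eqI
    by (simp add: grad_lagrangian_def lagrangian_def mat_inner_eq_inner[OF assms(3)])
qed

definition KKT :: "(real ^ 'n \<Rightarrow> real) \<Rightarrow> (real ^ 'n \<Rightarrow> real ^ 'm ^ 'm) \<Rightarrow> real ^ 'n \<Rightarrow> bool" where
  "KKT f G x \<longleftrightarrow> x \<in> feasible G \<and>
     (\<exists>Y \<in> psd_cone. grad_lagrangian f G x Y = 0 \<and> mat_inner (G x) Y = 0)"


section \<open>Weak-CPLD\<close>

text \<open>
  Dependence of indexed families: a family with a repeated member is linearly dependent, which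
  \<^const>\<open>dependent\<close> applied to the set of members would not capture.
\<close>

definition lin_dep_family :: "(nat \<Rightarrow> 'a::real_vector) \<Rightarrow> nat set \<Rightarrow> bool" where
  "lin_dep_family z J \<longleftrightarrow>
     (\<exists>\<alpha>. (\<exists>i\<in>J. \<alpha> i \<noteq> 0) \<and> (\<Sum>i\<in>J. \<alpha> i *\<^sub>R z i) = 0)"

definition pos_lin_dep_family :: "(nat \<Rightarrow> 'a::real_vector) \<Rightarrow> nat set \<Rightarrow> bool" where
  "pos_lin_dep_family z J \<longleftrightarrow>
     (\<exists>\<alpha>. (\<forall>i\<in>J. 0 \<le> \<alpha> i) \<and> (\<exists>i\<in>J. \<alpha> i \<noteq> 0) \<and> (\<Sum>i\<in>J. \<alpha> i *\<^sub>R z i) = 0)"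

text \<open>
  \<open>inf sequentially (principal I)\<close> is the filter of \<open>k \<rightarrow> \<infinity>\<close> along \<open>k \<in> I\<close>.
\<close>

definition weak_CPLD :: "(real ^ 'n \<Rightarrow> real ^ 'm ^ 'm) \<Rightarrow> real ^ 'n \<Rightarrow> bool" where
  "weak_CPLD G xbar \<longleftrightarrow> xbar \<in> feasible G \<and>
     (let r = rank (G xbar) in
       r = CARD('m) \<or>
       (\<forall>x. x \<longlonglongrightarrow> xbar \<longrightarrow>
         (\<exists>I E Ebar. infinite I \<and>
           (\<forall>k\<in>I. E k \<in> eigvec_mats r (G (x k))) \<and>
           (\<forall>i\<in>{1..CARD('m) - r}.
              ((\<lambda>k. E k i) \<longlongrightarrow> Ebar i) (inf sequentially (principal I))) \<and>
           (\<forall>J \<subseteq> {1..CARD('m) - r}.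
              pos_lin_dep_family (diag_vec G xbar Ebar) J \<longrightarrow>
              (\<forall>\<^sub>F k in inf sequentially (principal I).
                 lin_dep_family (diag_vec G (x k) (E k)) J)))))"

end

theory Submission
  imports Defs
begin

text \<open>
  Near \<open>xbar\<close> the matrix \<open>G x\<close> stays positive definite on the range of \<open>G xbar\<close>, so its \<open>r\<close> largest
  eigenvalues are positive and the projection of \<open>- G x\<close> onto the cone only involves the columns of any
  \<open>E \<in> eigvec_mats r (G x)\<close>: it is the sum of the rank-one matrices \<open>max 0 (- \<lambda>\<^sub>r\<^sub>+\<^sub>i) e\<^sub>i e\<^sub>i\<^sup>T\<close>. Hence the
  penalty condition says that \<open>\<nabla>f (x k)\<close> is, up to a vanishing error, a conic combination of the vectors
  \<open>diag_vec G (x k) (E k) i\<close>. By the conic Caratheodory theorem these may be taken linearly independent,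
  over a fixed index set \<open>J\<close>, and weak-CPLD then forces the multipliers to be bounded along a subsequence.
  A local minimizer is a limit of minimizers of \<open>f + |x - xbar|\<^sup>2/2 + k/2 dist(G x, psd)\<^sup>2\<close>, which
  reduces the second claim to the first.
\<close>

section \<open>Symmetric matrices and orthonormal eigenvectors\<close>

lemma sym_mats_inner:
  assumes "M \<in> sym_mats"
  shows "(M *v a) \<bullet> b = a \<bullet> (M *v b)"
  using assms by (metis (mono_tags) dot_lmul_matrix mem_Collect_eq sym_mats_def transpose_matrix_vector)

text \<open>The rank-one matrix u u^T. Pairing with it makes the quadratic form of a matrix a linear
  functional of that matrix, see \<open>inner_outer\<close>.\<close>

definition outer :: "real ^ 'm \<Rightarrow> real ^ 'm ^ 'm" where
  "outer u = (\<chi> i j. u $ i * u $ j)"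

lemma outer_sym: "outer u \<in> sym_mats"
  by (simp add: outer_def sym_mats_def transpose_def mult.commute)

lemma inner_outer: "A \<bullet> outer u = u \<bullet> (A *v u)"
  by (simp add: outer_def inner_vec_def matrix_vector_mult_def sum_distrib_left ac_simps)

lemma outer_mult: "outer u *v w = (u \<bullet> w) *\<^sub>R u"
  by (simp add: outer_def matrix_vector_mult_def inner_vec_def vec_eq_iff sum_distrib_left ac_simps)

lemma inner_outer_outer: "outer u \<bullet> outer w = (u \<bullet> w)\<^sup>2"
  by (simp add: inner_outer outer_mult power2_eq_square inner_commute)

lemma norm_outer: "norm (outer u) = (norm u)\<^sup>2"
  by (simp add: norm_eq_sqrt_inner inner_outer_outer)

lemma tendsto_outer [tendsto_intros]:
  "(u \<longlongrightarrow> l) F \<Longrightarrow> ((\<lambda>k. outer (u k)) \<longlongrightarrow> outer l) F"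
  unfolding outer_def by (intro tendsto_intros)

lemma sym_mats_subspace: "subspace sym_mats"
  by (auto simp: subspace_def sym_mats_def transpose_def vec_eq_iff)

lemmas sym_mats_closed_ops =
  subspace_add[OF sym_mats_subspace] subspace_diff[OF sym_mats_subspace]
  subspace_scale[OF sym_mats_subspace] subspace_0[OF sym_mats_subspace]

lemma matrix_vector_scaleR_left: "(c *\<^sub>R A) *v x = c *\<^sub>R (A *v (x :: real ^ 'n))"
  by (simp add: matrix_vector_mult_def vec_eq_iff sum_distrib_left mult.assoc)

section \<open>Spectral theorem on invariant subspaces\<close>

lemma zero_of_quadratic_nonneg:
  fixes a b :: real
  assumes "\<And>t. 0 \<le> t * a + t\<^sup>2 * b"
  shows "a = 0"
proof (rule ccontr)
  assume "a \<noteq> 0"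
  have b: "b \<ge> 0"
    using assms[of 1] assms[of "-1"] by simp
  \<comment> \<open>The values at 1 and -1 add up to 2 b, so b is nonnegative and the denominator is
    positive even for b = 0. With this t the quadratic takes the value - t^2.\<close>
  define t where "t = - a / (b + 1)"
  have a: "a = - (t * (b + 1))"
    using b by (simp add: t_def)
  have "t * a + t\<^sup>2 * b = - t\<^sup>2"
    unfolding a by (simp add: algebra_simps power2_eq_square)
  moreover have "t\<^sup>2 > 0"
    using b \<open>a \<noteq> 0\<close> by (simp add: t_def)
  ultimately show False
    using assms[of t] by simp
qed

text \<open>A maximizer of the Rayleigh quotient over the unit sphere of \<open>W\<close> is
  stationary along \<open>W\<close>, so the residual \<open>\<mu> *\<^sub>R x - M *v x\<close> is
  orthogonal to \<open>W\<close>. By invariance it also lies in \<open>W\<close>, hence it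
  vanishes.\<close>

lemma sym_has_eigvec:
  fixes M :: "real ^ 'm ^ 'm"
  assumes M: "M \<in> sym_mats" and W: "subspace W" "W \<noteq> {0}" "\<And>w. w \<in> W \<Longrightarrow> M *v w \<in> W"
  obtains x where "x \<in> W" "norm x = 1" "M *v x = (x \<bullet> (M *v x)) *\<^sub>R x"
proof -
  let ?S = "W \<inter> sphere 0 1"
  obtain w0 where "w0 \<in> W" "w0 \<noteq> 0"
    using W subspace_0 by blast
  then have "w0 /\<^sub>R norm w0 \<in> ?S"
    using W by (simp add: subspace_scale)
  then have ne: "?S \<noteq> {}" by blast
  have cpt: "compact ?S"
    using closed_Int_compact[OF closed_subspace[OF W(1)] compact_sphere] .
  have cont: "continuous_on ?S (\<lambda>x. x \<bullet> (M *v x))"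
    by (intro continuous_intros)
  obtain x where x: "x \<in> ?S" and max: "\<And>y. y \<in> ?S \<Longrightarrow> y \<bullet> (M *v y) \<le> x \<bullet> (M *v x)"
    using continuous_attains_sup[OF cpt ne cont] by blast
  define \<mu> where "\<mu> = x \<bullet> (M *v x)"
  have ub: "y \<bullet> (M *v y) \<le> \<mu> * (y \<bullet> y)" if "y \<in> W" for y
  proof (cases "y = 0")
    case False
    then have "y /\<^sub>R norm y \<in> ?S"
      using W that by (simp add: subspace_scale)
    from max[OF this] have "(y \<bullet> (M *v y)) / (norm y)\<^sup>2 \<le> \<mu>"
      by (simp add: \<mu>_def matrix_vector_mult_scaleR power2_eq_square divide_simps)
    then show ?thesis
      using False by (simp add: divide_simps dot_square_norm)
  qed simp
  have xx: "x \<bullet> x = 1"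
    using x by (simp add: dot_square_norm)
  have orth: "(\<mu> *\<^sub>R x - M *v x) \<bullet> y = 0" if y: "y \<in> W" for y
  proof -
    \<comment> \<open>This is \<open>ub\<close> expanded at \<open>x + t *\<^sub>R y\<close>: the
      constant terms cancel because \<open>x\<close> attains the maximum, and symmetry of
      \<open>M\<close> merges the two mixed terms.\<close>
    have "0 \<le> t * (2 * ((\<mu> *\<^sub>R x - M *v x) \<bullet> y)) + t\<^sup>2 * (\<mu> * (y \<bullet> y) - y \<bullet> (M *v y))" for t
    proof -
      have "x + t *\<^sub>R y \<in> W"
        using x y W by (simp add: subspace_add subspace_scale)
      from ub[OF this] show ?thesis
        using sym_mats_inner[OF M, of x y]
        by (simp add: matrix_vector_mult_scaleR matrix_vector_right_distrib inner_simps xx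
          inner_commute[of y x] inner_commute[of y "M *v x"] \<mu>_def[symmetric] algebra_simps power2_eq_square)
    qed
    from zero_of_quadratic_nonneg[OF this] show ?thesis by simp
  qed
  have "\<mu> *\<^sub>R x - M *v x \<in> W"
    using x W by (simp add: subspace_diff subspace_scale)
  from orth[OF this] have "M *v x = \<mu> *\<^sub>R x" by simp
  with x show thesis
    by (intro that[of x]) (auto simp: \<mu>_def)
qed

text \<open>Eigenvalues are not carried along: for a unit eigenvector the eigenvalue is its Rayleigh
  quotient. A plain set suits the later unions, subsets and spans.\<close>

definition orthonormal_eigvecs :: "real ^ 'm ^ 'm \<Rightarrow> (real ^ 'm) set \<Rightarrow> bool" where
  "orthonormal_eigvecs M B \<longleftrightarrow> pairwise orthogonal B \<and>
     (\<forall>b\<in>B. norm b = 1 \<and> M *v b = (b \<bullet> (M *v b)) *\<^sub>R b)"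

lemma orthonormal_eigvecs_finite: "orthonormal_eigvecs M B \<Longrightarrow> finite B"
  by (simp add: orthonormal_eigvecs_def pairwise_orthogonal_imp_finite)

lemma orthonormal_eigvecs_subset: "orthonormal_eigvecs M B \<Longrightarrow> C \<subseteq> B \<Longrightarrow> orthonormal_eigvecs M C"
  by (auto simp: orthonormal_eigvecs_def intro: pairwise_subset)

lemma orthonormal_eigvecs_independent: "orthonormal_eigvecs M B \<Longrightarrow> independent B"
  by (rule pairwise_orthogonal_independent) (auto simp: orthonormal_eigvecs_def)

text \<open>Induction on the dimension: one eigenvector is split off, and symmetry of
  \<open>M\<close> makes its orthogonal complement within \<open>W\<close> invariant again. A
  general \<open>W\<close> serves this induction and also the complement of prescribed eigenvectors
  in \<open>eigvec_mats_complement\<close>.\<close>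

lemma spectral_subspace:
  fixes M :: "real ^ 'm ^ 'm"
  assumes M: "M \<in> sym_mats" and "subspace W" "\<And>w. w \<in> W \<Longrightarrow> M *v w \<in> W"
  shows "\<exists>B. orthonormal_eigvecs M B \<and> span B = W"
  using assms(2,3)
proof (induction "dim W" arbitrary: W rule: less_induct)
  case less
  show ?case
  proof (cases "W = {0}")
    case True
    then show ?thesis
      by (intro exI[of _ "{}"]) (simp add: orthonormal_eigvecs_def)
  next
    case False
    obtain x where x: "x \<in> W" "norm x = 1" "M *v x = (x \<bullet> (M *v x)) *\<^sub>R x"
      using sym_has_eigvec[OF M less.prems(1) False less.prems(2)] by blast
    have xx: "x \<bullet> x = 1"
      using x by (simp add: dot_square_norm)
    let ?W = "W \<inter> {w. orthogonal x w}"
    have sub: "subspace ?W"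
      by (intro subspace_inter less.prems subspace_orthogonal_to_vector)
    have "x \<notin> ?W"
      using xx by (simp add: orthogonal_def)
    then have "?W \<subset> W"
      using x(1) by blast
    then have "dim ?W < dim W"
      using less.prems(1) sub by (metis dim_psubset span_eq_iff)
    moreover have "M *v w \<in> ?W" if "w \<in> ?W" for w
    proof -
      have "x \<bullet> (M *v w) = (M *v x) \<bullet> w"
        by (simp add: sym_mats_inner[OF M])
      also have "\<dots> = 0"
        using that by (subst x(3)) (simp add: orthogonal_def)
      finally show ?thesis
        using that less.prems(2) by (simp add: orthogonal_def)
    qed
    ultimately obtain B where B: "orthonormal_eigvecs M B" "span B = ?W"
      using less.hyps[OF _ sub] by blast
    have oB: "orthogonal x b" if "b \<in> B" for b
      using that B(2) span_base by fastforce
    have "orthonormal_eigvecs M (insert x B)"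
      using B(1) oB x by (auto simp: orthonormal_eigvecs_def pairwise_insert orthogonal_commute)
    moreover have "span (insert x B) = W"
    proof
      show "span (insert x B) \<subseteq> W"
        using B(2) x(1) less.prems(1) by (intro span_minimal) (use span_superset in fastforce)+
      show "W \<subseteq> span (insert x B)"
      proof
        fix w assume "w \<in> W"
        then have "w - (x \<bullet> w) *\<^sub>R x \<in> ?W"
          using x(1) less.prems(1) xx
          by (simp add: subspace_diff subspace_scale orthogonal_def inner_simps)
        then have "w - (x \<bullet> w) *\<^sub>R x \<in> span B"
          using B(2) by simp
        then show "w \<in> span (insert x B)"
          by (auto simp: span_insert)
      qed
    qed
    ultimately show ?thesis by blast
  qed
qed

lemma spectral_expand_vec:
  assumes "orthonormal_eigvecs M B" "u \<in> span B"
  shows "M *v u = (\<Sum>b\<in>B. ((b \<bullet> (M *v b)) * (u \<bullet> b)) *\<^sub>R b)"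
proof -
  have "u = (\<Sum>b\<in>B. (u \<bullet> b) *\<^sub>R b)"
    using assms orthonormal_eigvecs_finite[OF assms(1)]
    by (subst orthonormal_basis_expand) (auto simp: orthonormal_eigvecs_def)
  then have "M *v u = (\<Sum>b\<in>B. (u \<bullet> b) *\<^sub>R (M *v b))"
    by (metis (no_types, lifting) linear_sum[OF matrix_vector_mul_linear] matrix_vector_mult_scaleR sum.cong)
  also have "\<dots> = (\<Sum>b\<in>B. ((b \<bullet> (M *v b)) * (u \<bullet> b)) *\<^sub>R b)"
  proof (rule sum.cong[OF refl])
    fix b assume "b \<in> B"
    then have "M *v b = (b \<bullet> (M *v b)) *\<^sub>R b"
      using assms by (simp add: orthonormal_eigvecs_def)
    then show "(u \<bullet> b) *\<^sub>R (M *v b) = ((b \<bullet> (M *v b)) * (u \<bullet> b)) *\<^sub>R b"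
      by (metis mult.commute scaleR_scaleR)
  qed
  finally show ?thesis .
qed

lemma spectral_expand_quadratic:
  assumes "orthonormal_eigvecs M B" "u \<in> span B"
  shows "u \<bullet> (M *v u) = (\<Sum>b\<in>B. (b \<bullet> (M *v b)) * (u \<bullet> b)\<^sup>2)"
  by (simp add: spectral_expand_vec[OF assms] inner_sum_right power2_eq_square mult.assoc)

lemma spectral_expand_mat:
  assumes "orthonormal_eigvecs M B" "span B = UNIV"
  shows "M = (\<Sum>b\<in>B. (b \<bullet> (M *v b)) *\<^sub>R outer b)"
proof -
  have "M *v u = (\<Sum>b\<in>B. (b \<bullet> (M *v b)) *\<^sub>R outer b) *v u" for u
  proof -
    have "(\<Sum>b\<in>B. (b \<bullet> (M *v b)) *\<^sub>R outer b) *v u = (\<Sum>b\<in>B. ((b \<bullet> (M *v b)) *\<^sub>R outer b) *v u)"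
      using orthonormal_eigvecs_finite[OF assms(1)]
      by (induction B rule: finite_induct) (auto simp: matrix_vector_mult_add_rdistrib)
    then show ?thesis
      using assms by (simp add: spectral_expand_vec matrix_vector_scaleR_left outer_mult inner_commute)
  qed
  then show ?thesis
    by (subst matrix_eq) blast
qed

section \<open>Eigenbases and roots of the characteristic polynomial\<close>

text \<open>The matrix whose columns are the basis vectors diagonalizes \<open>M\<close>, so the
  characteristic polynomial splits into the factors t - d_j. This ties \<open>eigval\<close> to an
  arbitrary orthonormal eigenbasis, multiplicities included.\<close>

lemma charpoly_roots:
  fixes M :: "real ^ 'm ^ 'm"
  assumes B: "orthonormal_eigvecs M B" "span B = UNIV"
  shows "proots (charpoly M) = image_mset (\<lambda>b. b \<bullet> (M *v b)) (mset_set B)"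
proof -
  have fin: "finite B"
    using B(1) by (rule orthonormal_eigvecs_finite)
  have "card B = CARD('m)"
    using orthonormal_eigvecs_independent[OF B(1)] B(2)
    by (metis DIM_cart DIM_real dim_UNIV dim_eq_card dim_span mult.right_neutral)
  then obtain h :: "'m \<Rightarrow> real ^ 'm" where h: "bij_betw h UNIV B"
    using fin by (metis finite finite_same_card_bij)
  define d where "d j = h j \<bullet> (M *v h j)" for j
  define Q :: "real ^ 'm ^ 'm" where "Q = (\<chi> i j. h j $ i)"
  have hB: "h j \<in> B" for j
    using h by (auto simp: bij_betw_def)
  have eig: "M *v h j = d j *\<^sub>R h j" for j
    using B(1) hB[of j] by (simp add: orthonormal_eigvecs_def d_def)
  have orth: "h i \<bullet> h j = (if i = j then 1 else 0)" for i j
  proof (cases "i = j")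
    case False
    then have "h i \<noteq> h j"
      using h by (auto simp: bij_betw_def inj_on_def)
    then show ?thesis
      using False B(1) hB[of i] hB[of j] by (auto simp: orthonormal_eigvecs_def pairwise_def orthogonal_def)
  qed (use B(1) hB in \<open>auto simp: orthonormal_eigvecs_def dot_square_norm\<close>)
  have "transpose Q ** Q = mat 1"
    using orth by (simp add: vec_eq_iff matrix_matrix_mult_def transpose_def Q_def mat_def inner_vec_def)
  then have detQ: "det Q \<noteq> 0"
    by (metis det_I det_mul mult_zero_right zero_neq_one)
  \<comment> \<open>The comparison is made value by value, since \<open>poly_charpoly\<close>
    describes the polynomial through its values; these determine a real polynomial.\<close>
  have "poly (charpoly M) t = poly (\<Prod>j\<in>UNIV. [:- d j, 1:]) t" for t
  proof -
    let ?D = "\<chi> i j. if i = j then t - d j else 0 :: real ^ 'm ^ 'm"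
    have "(mat t - M) ** Q = Q ** ?D"
    proof -
      have "((mat t - M) ** Q) $ i $ j = (Q ** ?D) $ i $ j" for i j
      proof -
        have "((mat t - M) ** Q) $ i $ j = t * h j $ i - (M *v h j) $ i"
          by (simp add: matrix_matrix_mult_def matrix_vector_mult_def mat_def Q_def left_diff_distrib sum_subtractf
              if_distrib[where f = "\<lambda>x. x * _"] cong: if_cong)
        also have "\<dots> = (t - d j) * h j $ i"
          by (simp add: eig left_diff_distrib)
        also have "\<dots> = (Q ** ?D) $ i $ j"
          by (simp add: matrix_matrix_mult_def Q_def if_distrib[where f = "\<lambda>x. _ * x"] cong: if_cong)
        finally show ?thesis .
      qed
      then show ?thesis
        by (simp add: vec_eq_iff)
    qed
    from arg_cong[OF this, of det] have "det (mat t - M) * det Q = det Q * det ?D"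
      by (simp only: det_mul)
    then have "det (mat t - M) = det ?D"
      using detQ by simp
    also have "\<dots> = (\<Prod>j\<in>UNIV. t - d j)"
      by (subst det_diagonal) auto
    finally show ?thesis
      by (simp add: poly_charpoly poly_prod)
  qed
  then have "charpoly M = (\<Prod>j\<in>UNIV. [:- d j, 1:])"
    using poly_eq_poly_eq_iff by blast
  then have "proots (charpoly M) = (\<Sum>j\<in>UNIV. {#d j#})"
    by (simp add: proots_prod)
  also have "\<dots> = image_mset d (mset_set UNIV)"
  proof -
    have "(\<Sum>j\<in>A. {#d j#}) = image_mset d (mset_set A)" if "finite A" for A
      using that by (induction A rule: finite_induct) auto
    then show ?thesis by simp
  qed
  also have "\<dots> = image_mset (\<lambda>b. b \<bullet> (M *v b)) (image_mset h (mset_set UNIV))"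
    by (simp add: multiset.map_comp o_def d_def[abs_def])
  also have "image_mset h (mset_set UNIV) = mset_set B"
    using h by (simp add: image_mset_mset_set bij_betw_def)
  finally show ?thesis .
qed

section \<open>The cone of positive semidefinite matrices\<close>

lemma psd_outer: "outer u \<in> psd_cone"
  by (simp add: psd_cone_def outer_sym outer_mult inner_commute)

lemma psd_add: "A \<in> psd_cone \<Longrightarrow> B \<in> psd_cone \<Longrightarrow> A + B \<in> psd_cone"
  by (simp add: psd_cone_def sym_mats_closed_ops matrix_vector_mult_add_rdistrib inner_add_right)

lemma psd_scaleR: "0 \<le> c \<Longrightarrow> A \<in> psd_cone \<Longrightarrow> c *\<^sub>R A \<in> psd_cone"
  by (simp add: psd_cone_def sym_mats_closed_ops matrix_vector_scaleR_left)

lemma psd_0: "0 \<in> psd_cone"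
  by (simp add: psd_cone_def sym_mats_closed_ops)

lemma psd_sum: "(\<And>i. i \<in> I \<Longrightarrow> A i \<in> psd_cone) \<Longrightarrow> (\<Sum>i\<in>I. A i) \<in> psd_cone"
  by (induction I rule: infinite_finite_induct) (auto simp: psd_0 psd_add)

lemma psd_convex: "convex psd_cone"
  by (simp add: convex_def psd_add psd_scaleR)

lemma psd_closed: "closed (psd_cone :: (real ^ 'm ^ 'm) set)"
proof -
  \<comment> \<open>Through \<open>outer\<close>, the cone becomes a subspace intersected with
    closed half-spaces.\<close>
  have eq: "psd_cone = sym_mats \<inter> (\<Inter>u. {A :: real ^ 'm ^ 'm. 0 \<le> A \<bullet> outer u})"
    by (auto simp: psd_cone_def inner_outer)
  have "closed (\<Inter>u. {A :: real ^ 'm ^ 'm. 0 \<le> A \<bullet> outer u})"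
    by (intro closed_INT closed_Collect_le continuous_intros ballI)
  then show ?thesis
    unfolding eq by (rule closed_Int[OF closed_subspace[OF sym_mats_subspace]])
qed

lemma sym_spectral:
  assumes "M \<in> sym_mats"
  obtains B where "orthonormal_eigvecs M B" "span B = UNIV"
  using spectral_subspace[OF assms subspace_UNIV] by auto

text \<open>One half of the self-duality of the cone: a spectral decomposition of \<open>Q\<close>
  turns the pairing into a nonnegative combination of values of the form of
  \<open>A\<close>.\<close>

lemma psd_inner_nonneg:
  assumes "A \<in> psd_cone" "Q \<in> psd_cone"
  shows "0 \<le> A \<bullet> Q"
proof -
  obtain B where B: "orthonormal_eigvecs Q B" "span B = UNIV"
    using assms sym_spectral unfolding psd_cone_def by blast
  have "A \<bullet> Q = (\<Sum>b\<in>B. (b \<bullet> (Q *v b)) * (b \<bullet> (A *v b)))"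
    by (subst spectral_expand_mat[OF B]) (simp add: inner_sum_right inner_outer)
  also have "\<dots> \<ge> 0"
    using assms by (intro sum_nonneg) (simp add: psd_cone_def)
  finally show ?thesis .
qed

text \<open>In an eigenbasis the form is a sum of nonnegative terms, so every basis vector has
  eigenvalue 0 or is orthogonal to \<open>u\<close>.\<close>

lemma psd_kernel:
  assumes "M \<in> psd_cone" "u \<bullet> (M *v u) = 0"
  shows "M *v u = 0"
proof -
  obtain B where B: "orthonormal_eigvecs M B" "span B = UNIV"
    using assms sym_spectral unfolding psd_cone_def by blast
  have "(\<Sum>b\<in>B. (b \<bullet> (M *v b)) * (u \<bullet> b)\<^sup>2) = 0"
    using spectral_expand_quadratic[OF B(1), of u] B(2) assms(2) by simp
  then have "\<forall>b\<in>B. (b \<bullet> (M *v b)) * (u \<bullet> b)\<^sup>2 = 0"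
    using assms(1) orthonormal_eigvecs_finite[OF B(1)]
    by (subst (asm) sum_nonneg_eq_0_iff) (auto simp: psd_cone_def)
  then show ?thesis
    using B by (subst spectral_expand_vec[OF B(1)]) (auto intro!: sum.neutral)
qed

section \<open>Projection onto the cone and Moreau decomposition\<close>

text \<open>The matrix - M is the difference of \<open>P\<close> and \<open>M + P\<close>, two
  orthogonal members of the cone. In the squared distance to another \<open>Q\<close> of the cone,
  the cross term pairs \<open>M + P\<close> with \<open>Q - P\<close>, and by self-duality it is
  nonnegative.\<close>

lemma proj_psd_eqI:
  assumes P: "P \<in> psd_cone" and MP: "M + P \<in> psd_cone" and orth: "(M + P) \<bullet> P = 0"
  shows "proj_psd (- M) = P"
proof -
  have "dist (- M) P \<le> dist (- M) Q" if "Q \<in> psd_cone" for Q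
  proof -
    have "0 \<le> (M + P) \<bullet> (Q - P)"
      using psd_inner_nonneg[OF MP that] orth by (simp add: inner_diff_right)
    moreover have "(norm (- M - Q))\<^sup>2 = (norm (- M - P))\<^sup>2 + 2 * ((M + P) \<bullet> (Q - P)) + (norm (Q - P))\<^sup>2"
      unfolding power2_norm_eq_inner by (simp add: inner_simps inner_commute algebra_simps)
    ultimately have "(norm (- M - P))\<^sup>2 \<le> (norm (- M - Q))\<^sup>2"
      using zero_le_power2[of "norm (Q - P)"] by linarith
    from power2_le_imp_le[OF this norm_ge_zero] show ?thesis
      by (simp add: dist_norm)
  qed
  then show ?thesis
    unfolding proj_psd_def
    by (intro closest_point_unique[symmetric] psd_convex psd_closed P) blast
qed

text \<open>Moreau decomposition for the self-dual cone, obtained from the variational inequality of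
  the projection. It later converts the derivative of the squared distance to the cone into the
  multiplier of the penalty condition.\<close>

lemma proj_psd_uminus:
  fixes A :: "real ^ 'm ^ 'm"
  assumes "A \<in> sym_mats"
  shows "proj_psd (- A) = proj_psd A - A"
proof (rule proj_psd_eqI)
  let ?Q = "closest_point psd_cone A"
  have Q: "?Q \<in> psd_cone"
    using closest_point_in_set[OF psd_closed] psd_0 by blast
  have le: "(A - ?Q) \<bullet> (Z - ?Q) \<le> 0" if "Z \<in> psd_cone" for Z
    using closest_point_dot[OF psd_convex psd_closed that] .
  show "A + (proj_psd A - A) \<in> psd_cone"
    using Q by (simp add: proj_psd_def)
  have "?Q - A \<in> sym_mats"
    using Q assms by (auto simp: psd_cone_def intro: sym_mats_closed_ops)
  \<comment> \<open>The variational inequality is tested at \<open>?Q + outer u\<close>.\<close>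
  moreover have "0 \<le> u \<bullet> ((?Q - A) *v u)" for u
    using le[OF psd_add[OF Q psd_outer[of u]]]
    by (simp add: inner_diff_left flip: inner_outer)
  ultimately show "proj_psd A - A \<in> psd_cone"
    by (simp add: psd_cone_def proj_psd_def)
  \<comment> \<open>The test points 0 and \<open>2 *\<^sub>R ?Q\<close> give the two opposite
    inequalities.\<close>
  have "(A - ?Q) \<bullet> ?Q = 0"
    using le[OF psd_0] le[OF psd_scaleR[OF _ Q, of 2]] by (simp add: inner_simps scaleR_2)
  then show "(A + (proj_psd A - A)) \<bullet> (proj_psd A - A) = 0"
    by (simp add: proj_psd_def inner_simps inner_commute)
qed

section \<open>Ordered eigenvalues\<close>

text \<open>The orthogonal complement of the given columns is invariant and has its own eigenbasis
  \<open>B\<close>. The columns account for the last m - r entries of the sorted spectrum;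
  cancelling these as multisets leaves the first r entries for \<open>B\<close>, whence the
  comparison.\<close>

lemma eigvec_mats_complement:
  fixes M :: "real ^ 'm ^ 'm"
  assumes M: "M \<in> sym_mats" and r: "r \<le> CARD('m)" and E: "E \<in> eigvec_mats r M"
  defines "I \<equiv> {1..CARD('m) - r}"
  obtains B where "orthonormal_eigvecs M (E ` I \<union> B)" "span (E ` I \<union> B) = UNIV" "E ` I \<inter> B = {}"
    "\<And>b i. b \<in> B \<Longrightarrow> i \<in> I \<Longrightarrow> eigval M (r + i) \<le> b \<bullet> (M *v b)"
proof -
  define \<mu> where "\<mu> b = b \<bullet> (M *v b)" for b
  have orth: "E i \<bullet> E j = (if i = j then 1 else 0)" if "i \<in> I" "j \<in> I" for i j
    using E that by (simp add: eigvec_mats_def I_def)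
  have eig: "M *v E i = eigval M (r + i) *\<^sub>R E i" if "i \<in> I" for i
    using E that by (simp add: eigvec_mats_def I_def)
  have \<mu>E: "\<mu> (E i) = eigval M (r + i)" if "i \<in> I" for i
    using that by (simp add: \<mu>_def eig orth)
  have injE: "inj_on E I"
  proof (rule inj_onI)
    fix i j assume "i \<in> I" "j \<in> I" "E i = E j"
    then show "i = j"
      using orth[of i j] orth[of i i] by (simp split: if_splits)
  qed
  let ?W = "{w. \<forall>e\<in>E ` I. orthogonal e w}"
  have "M *v w \<in> ?W" if "w \<in> ?W" for w
    using that by (auto simp: orthogonal_def eig simp flip: sym_mats_inner[OF M])
  from spectral_subspace[OF M subspace_orthogonal_to_vectors this]
  obtain B where B: "orthonormal_eigvecs M B" "span B = ?W" by blast
  have BW: "orthogonal (E i) b" if "b \<in> B" "i \<in> I" for b i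
    using that B(2) span_base[of b B] by blast
  have disj: "E ` I \<inter> B = {}"
    using BW orth by (fastforce simp: orthogonal_def)
  have oE: "orthonormal_eigvecs M (E ` I)"
    using orth eig by (auto simp: orthonormal_eigvecs_def pairwise_def orthogonal_def norm_eq_sqrt_inner)
  have oEB: "orthonormal_eigvecs M (E ` I \<union> B)"
    using oE B(1) BW unfolding orthonormal_eigvecs_def pairwise_def
    by (auto simp: orthogonal_commute)
  have "u \<in> span (E ` I \<union> B)" for u
  proof -
    let ?p = "\<Sum>j\<in>I. (u \<bullet> E j) *\<^sub>R E j"
    have "E i \<bullet> (u - ?p) = 0" if "i \<in> I" for i
    proof -
      have "E i \<bullet> ?p = (\<Sum>j\<in>I. if i = j then u \<bullet> E j else 0)"
        unfolding inner_sum_right using orth[OF that] by (intro sum.cong) auto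
      also have "\<dots> = u \<bullet> E i"
        using that by (simp add: I_def)
      finally show ?thesis
        by (simp add: inner_diff_right inner_commute)
    qed
    then have "u - ?p \<in> span B"
      unfolding B(2) by (auto simp: orthogonal_def)
    moreover have "?p \<in> span (E ` I)"
      by (intro span_sum span_scale span_base imageI)
    ultimately have "?p + (u - ?p) \<in> span (E ` I \<union> B)"
      by (meson span_add span_mono sup_ge1 sup_ge2 subsetD)
    then show ?thesis by simp
  qed
  then have span: "span (E ` I \<union> B) = UNIV" by blast
  define L where "L = rev (sorted_list_of_multiset (proots (charpoly M)))"
  have finB: "finite B" and finI: "finite I"
    using orthonormal_eigvecs_finite[OF B(1)] by (auto simp: I_def)
  have "card (E ` I \<union> B) = CARD('m)"
    using orthonormal_eigvecs_independent[OF oEB] span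
    by (metis DIM_cart DIM_real dim_UNIV dim_eq_card dim_span mult.right_neutral)
  have msL: "mset L = image_mset \<mu> (mset_set (E ` I \<union> B))"
    by (simp add: L_def charpoly_roots[OF oEB span] \<mu>_def[abs_def])
  then have len: "length L = CARD('m)"
    using \<open>card (E ` I \<union> B) = CARD('m)\<close> by (metis size_image_mset size_mset size_mset_set)
  \<comment> \<open>\<open>eigval M (r + i)\<close> is entry r + i - 1 of the zero-based list
    \<open>L\<close>, so i from 1 to m - r runs through exactly \<open>drop r L\<close>.\<close>
  have "drop r L = map (\<lambda>i. L ! (r + i - 1)) [1..<Suc (CARD('m) - r)]"
    by (rule nth_equalityI) (use len in \<open>auto simp del: upt_Suc\<close>)
  then have "mset (drop r L) = image_mset (\<lambda>i. L ! (r + i - 1)) (mset_set I)"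
    by (simp add: I_def atLeastLessThanSuc_atLeastAtMost mset_upt del: upt_Suc)
  also have "\<dots> = image_mset \<mu> (image_mset E (mset_set I))"
    unfolding multiset.map_comp
    by (rule image_mset_cong) (use finI in \<open>simp add: \<mu>E eigval_def L_def\<close>)
  also have "image_mset E (mset_set I) = mset_set (E ` I)"
    using injE by (rule image_mset_mset_set)
  finally have dropL: "mset (drop r L) = image_mset \<mu> (mset_set (E ` I))" .
  have "mset L = mset (take r L) + mset (drop r L)"
    by (metis append_take_drop_id mset_append)
  then have takeL: "mset (take r L) = image_mset \<mu> (mset_set B)"
    unfolding msL dropL using finB finI disj by (simp add: mset_set_Union)
  have "eigval M (r + i) \<le> \<mu> b" if b: "b \<in> B" and i: "i \<in> I" for b i
  proof -
    have "\<mu> b \<in> set (take r L)"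
      using b finB by (simp add: takeL flip: set_mset_mset)
    then obtain p where p: "p < r" "\<mu> b = L ! p"
      by (auto simp: in_set_conv_nth)
    have "L ! (r + i - 1) \<le> L ! p"
    proof (rule sorted_rev_nth_mono)
      show "sorted (rev L)" by (simp add: L_def)
    qed (use p i r len in \<open>auto simp: I_def\<close>)
    then show ?thesis
      using p by (simp add: eigval_def L_def)
  qed
  then show thesis
    using that[OF oEB span disj] by (simp add: \<mu>_def)
qed

text \<open>Adding the candidate to \<open>M\<close> replaces each eigenvalue along the columns by
  its positive part, so \<open>proj_psd_eqI\<close> applies once the remaining eigenvalues are
  nonnegative. The subspace \<open>V\<close> guarantees this.\<close>

lemma proj_psd_eigvec_mats:
  fixes M :: "real ^ 'm ^ 'm"
  assumes M: "M \<in> sym_mats" and r: "r \<le> CARD('m)" and E: "E \<in> eigvec_mats r M"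
    and V: "subspace V" "dim V = r" and pos: "\<And>u. u \<in> V \<Longrightarrow> u \<noteq> 0 \<Longrightarrow> 0 < u \<bullet> (M *v u)"
  shows "proj_psd (- M) = (\<Sum>i\<in>{1..CARD('m) - r}. max 0 (- eigval M (r + i)) *\<^sub>R outer (E i))"
proof (rule proj_psd_eqI)
  define I where "I = {1..CARD('m) - r}"
  obtain B where B: "orthonormal_eigvecs M (E ` I \<union> B)" "span (E ` I \<union> B) = UNIV" "E ` I \<inter> B = {}"
    and ge: "\<And>b i. b \<in> B \<Longrightarrow> i \<in> I \<Longrightarrow> eigval M (r + i) \<le> b \<bullet> (M *v b)"
    using eigvec_mats_complement[OF M r E] unfolding I_def by blast
  define c where "c i = max 0 (- eigval M (r + i))" for i
  let ?P = "\<Sum>i\<in>I. c i *\<^sub>R outer (E i)"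
  have orth: "E i \<bullet> E j = (if i = j then 1 else 0)" if "i \<in> I" "j \<in> I" for i j
    using E that by (simp add: eigvec_mats_def I_def)
  have eig: "M *v E i = eigval M (r + i) *\<^sub>R E i" if "i \<in> I" for i
    using E that by (simp add: eigvec_mats_def I_def)
  have injE: "inj_on E I"
  proof (rule inj_onI)
    fix i j assume "i \<in> I" "j \<in> I" "E i = E j"
    then show "i = j"
      using orth[of i j] orth[of i i] by (simp split: if_splits)
  qed
  have finI: "finite I" and finB: "finite B"
    using orthonormal_eigvecs_finite[OF B(1)] by (auto simp: I_def)
  \<comment> \<open>A dimension count in the style of Courant-Fischer: a negative eigenvalue at
    \<open>b\<close> bounds all eigenvalues along the columns from above, so the form is nonpositive
    on a space of dimension m - r + 1. That space meets \<open>V\<close>, of dimension r, in a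
    nonzero vector.\<close>
  have \<mu>B: "0 \<le> b \<bullet> (M *v b)" if b: "b \<in> B" for b
  proof (rule ccontr)
    assume neg: "\<not> 0 \<le> b \<bullet> (M *v b)"
    let ?T = "insert b (E ` I)"
    have sub: "?T \<subseteq> E ` I \<union> B"
      using b by blast
    have oT: "orthonormal_eigvecs M ?T"
      using B(1) sub by (rule orthonormal_eigvecs_subset)
    have "b \<notin> E ` I"
      using B(3) b by blast
    then have "card ?T = Suc (CARD('m) - r)"
      using finI card_image[OF injE] by (simp add: I_def)
    then have dimT: "dim (span ?T) = Suc (CARD('m) - r)"
      using orthonormal_eigvecs_independent[OF oT] by (simp add: dim_eq_card_independent)
    have "dim {x + y |x y. x \<in> span ?T \<and> y \<in> V} + dim (span ?T \<inter> V) = dim (span ?T) + dim V"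
      by (rule dim_sums_Int[OF subspace_span V(1)])
    moreover have "dim {x + y |x y. x \<in> span ?T \<and> y \<in> V} \<le> CARD('m)"
      using dim_subset_UNIV[of "{x + y |x y. x \<in> span ?T \<and> y \<in> V}"] by simp
    ultimately have "dim (span ?T \<inter> V) \<noteq> 0"
      using dimT V(2) r by linarith
    then obtain u where u: "u \<in> span ?T" "u \<in> V" "u \<noteq> 0"
      by (metis Int_iff dim_eq_0 singletonI subsetI)
    have "t \<bullet> (M *v t) \<le> 0" if "t \<in> ?T" for t
    proof (cases "t = b")
      case False
      then obtain i where i: "i \<in> I" "t = E i"
        using \<open>t \<in> ?T\<close> by blast
      then have "t \<bullet> (M *v t) = eigval M (r + i)"
        by (simp add: eig orth)
      then show ?thesis
        using ge[OF b i(1)] neg by linarith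
    qed (use neg in simp)
    then have "u \<bullet> (M *v u) \<le> 0"
      unfolding spectral_expand_quadratic[OF oT u(1)]
      by (intro sum_nonpos) (simp add: mult_nonpos_nonneg)
    then show False
      using pos[OF u(2,3)] by linarith
  qed
  show "(\<Sum>i\<in>{1..CARD('m) - r}. max 0 (- eigval M (r + i)) *\<^sub>R outer (E i)) \<in> psd_cone"
    by (intro psd_sum psd_scaleR psd_outer) simp
  then have P: "?P \<in> psd_cone"
    by (simp add: I_def c_def)
  have "0 \<le> u \<bullet> ((M + ?P) *v u)" for u
  proof -
    have "u \<bullet> (M *v u) = (\<Sum>b\<in>E ` I \<union> B. (b \<bullet> (M *v b)) * (u \<bullet> b)\<^sup>2)"
      by (rule spectral_expand_quadratic[OF B(1)]) (simp add: B(2))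
    also have "\<dots> = (\<Sum>b\<in>E ` I. (b \<bullet> (M *v b)) * (u \<bullet> b)\<^sup>2) + (\<Sum>b\<in>B. (b \<bullet> (M *v b)) * (u \<bullet> b)\<^sup>2)"
      by (intro sum.union_disjoint) (use finI finB B(3) in auto)
    also have "(\<Sum>b\<in>E ` I. (b \<bullet> (M *v b)) * (u \<bullet> b)\<^sup>2) = (\<Sum>i\<in>I. eigval M (r + i) * (u \<bullet> E i)\<^sup>2)"
      using eig orth by (simp add: sum.reindex[OF injE])
    finally have "u \<bullet> ((M + ?P) *v u) =
        (\<Sum>i\<in>I. (eigval M (r + i) + c i) * (u \<bullet> E i)\<^sup>2) + (\<Sum>b\<in>B. (b \<bullet> (M *v b)) * (u \<bullet> b)\<^sup>2)"
      by (simp add: inner_add_left inner_sum_left inner_outer_outer distrib_right sum.distrib inner_commute[of _ u]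
          flip: inner_outer)
    also have "\<dots> \<ge> 0"
    proof (rule add_nonneg_nonneg)
      have "0 \<le> eigval M (r + i) + c i" for i
        by (simp add: c_def)
      then show "0 \<le> (\<Sum>i\<in>I. (eigval M (r + i) + c i) * (u \<bullet> E i)\<^sup>2)"
        by (intro sum_nonneg mult_nonneg_nonneg) auto
      show "0 \<le> (\<Sum>b\<in>B. (b \<bullet> (M *v b)) * (u \<bullet> b)\<^sup>2)"
        using \<mu>B by (intro sum_nonneg mult_nonneg_nonneg) auto
    qed
    finally show ?thesis .
  qed
  then show "M + (\<Sum>i\<in>{1..CARD('m) - r}. max 0 (- eigval M (r + i)) *\<^sub>R outer (E i)) \<in> psd_cone"
    using M P by (simp add: psd_cone_def I_def c_def sym_mats_closed_ops)
  have Pi: "?P \<bullet> outer (E i) = c i" if "i \<in> I" for i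
  proof -
    have "?P \<bullet> outer (E i) = (\<Sum>j\<in>I. if j = i then c i else 0)"
      unfolding inner_sum_left using orth[OF _ that] by (intro sum.cong) (auto simp: inner_outer_outer)
    then show ?thesis
      using that finI by simp
  qed
  have "(M + ?P) \<bullet> outer (E i) = eigval M (r + i) + c i" if "i \<in> I" for i
  proof -
    have "M \<bullet> outer (E i) = eigval M (r + i)"
      using that by (simp add: inner_outer eig orth)
    then show ?thesis
      by (simp only: inner_add_left Pi[OF that])
  qed
  then have "(M + ?P) \<bullet> ?P = (\<Sum>i\<in>I. c i * (eigval M (r + i) + c i))"
    unfolding inner_sum_right by (intro sum.cong) auto
  \<comment> \<open>In every summand either \<open>c i = 0\<close> or
    \<open>c i = - eigval M (r + i)\<close>.\<close>
  also have "\<dots> = 0"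
    by (intro sum.neutral) (auto simp: c_def max_def)
  finally show "(M + (\<Sum>i\<in>{1..CARD('m) - r}. max 0 (- eigval M (r + i)) *\<^sub>R outer (E i))) \<bullet>
      (\<Sum>i\<in>{1..CARD('m) - r}. max 0 (- eigval M (r + i)) *\<^sub>R outer (E i)) = 0"
    by (simp add: I_def c_def)
qed

text \<open>By symmetry the range of \<open>M\<close> is orthogonal to its kernel, so with
  \<open>psd_kernel\<close> the form is positive definite on the range. Compactness of the unit
  sphere gives a uniform constant \<open>c\<close>, and a perturbation of Frobenius norm below
  \<open>c\<close> preserves positivity.\<close>

lemma psd_pos_on_range:
  fixes M :: "real ^ 'm ^ 'm"
  assumes M: "M \<in> psd_cone" and lim: "(N \<longlongrightarrow> M) F"
  shows "\<forall>\<^sub>F k in F. \<forall>u\<in>range ((*v) M). u \<noteq> 0 \<longrightarrow> 0 < u \<bullet> (N k *v u)"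
proof -
  let ?V = "range ((*v) M)"
  have V: "subspace ?V"
    by (rule linear_subspace_image[OF matrix_vector_mul_linear subspace_UNIV])
  have pos: "0 < u \<bullet> (M *v u)" if "u \<in> ?V" "u \<noteq> 0" for u
  proof -
    obtain z where z: "u = M *v z"
      using \<open>u \<in> ?V\<close> by blast
    have "u \<bullet> (M *v u) \<noteq> 0"
    proof
      assume "u \<bullet> (M *v u) = 0"
      then have "M *v u = 0"
        by (rule psd_kernel[OF M])
      then have "u \<bullet> u = 0"
        using M sym_mats_inner[of M z u] by (simp add: psd_cone_def flip: z)
      then show False
        using \<open>u \<noteq> 0\<close> by simp
    qed
    moreover have "0 \<le> u \<bullet> (M *v u)"
      using M by (simp add: psd_cone_def)
    ultimately show ?thesis by linarith
  qed
  have cpt: "compact (?V \<inter> sphere 0 1)"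
    using closed_Int_compact[OF closed_subspace[OF V] compact_sphere] .
  obtain c where c: "c > 0" "\<And>u. u \<in> ?V \<inter> sphere 0 1 \<Longrightarrow> c \<le> u \<bullet> (M *v u)"
  proof (cases "?V \<inter> sphere 0 1 = {}")
    case True
    \<comment> \<open>The range is trivial here, so the bound is vacuous and any positive constant
      serves.\<close>
    then show thesis
      by (intro that[of 1]) auto
  next
    case False
    have "continuous_on (?V \<inter> sphere 0 1) (\<lambda>u. u \<bullet> (M *v u))"
      by (intro continuous_intros)
    then obtain u0 where u0: "u0 \<in> ?V \<inter> sphere 0 1"
      "\<And>u. u \<in> ?V \<inter> sphere 0 1 \<Longrightarrow> u0 \<bullet> (M *v u0) \<le> u \<bullet> (M *v u)"
      using continuous_attains_inf[OF cpt False] by blast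
    moreover have "u0 \<in> ?V" "u0 \<noteq> 0"
      using u0(1) by force+
    ultimately show thesis
      using pos[of u0] by (intro that[of "u0 \<bullet> (M *v u0)"])
  qed
  have "\<forall>\<^sub>F k in F. dist (N k) M < c"
    using lim c(1) by (rule tendstoD)
  then show ?thesis
  proof eventually_elim
    case (elim k)
    show ?case
    proof (intro ballI impI)
      fix u assume u: "u \<in> ?V" "u \<noteq> 0"
      then have "u /\<^sub>R norm u \<in> ?V \<inter> sphere 0 1"
        using subspace_scale[OF V] by simp
      from c(2)[OF this] have "c \<le> (u \<bullet> (M *v u)) / (norm u)\<^sup>2"
        by (simp add: matrix_vector_mult_scaleR power2_eq_square divide_simps)
      then have cu: "c * (norm u)\<^sup>2 \<le> u \<bullet> (M *v u)"
        using u by (simp add: field_simps)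
      have "\<bar>(N k - M) \<bullet> outer u\<bar> \<le> norm (N k - M) * (norm u)\<^sup>2"
        using Cauchy_Schwarz_ineq2[of "N k - M" "outer u"] by (simp add: norm_outer)
      also have "\<dots> < c * (norm u)\<^sup>2"
        using elim u by (intro mult_strict_right_mono) (auto simp: dist_norm)
      finally have "- (c * (norm u)\<^sup>2) < u \<bullet> (N k *v u) - u \<bullet> (M *v u)"
        by (simp add: inner_diff_left flip: inner_outer)
      then show "0 < u \<bullet> (N k *v u)"
        using cu by linarith
    qed
  qed
qed

section \<open>Conic Caratheodory reduction and convergence of multipliers\<close>

lemma conic_Caratheodory:
  fixes z :: "nat \<Rightarrow> 'a::real_vector"
  assumes "finite N" "\<And>i. i \<in> N \<Longrightarrow> 0 < \<alpha> i"
  shows "\<exists>J \<beta>. J \<subseteq> N \<and> (\<forall>i\<in>J. 0 < \<beta> i) \<and> (\<Sum>i\<in>J. \<beta> i *\<^sub>R z i) = (\<Sum>i\<in>N. \<alpha> i *\<^sub>R z i)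
    \<and> \<not> lin_dep_family z J"
  using assms
proof (induction "card N" arbitrary: N \<alpha> rule: less_induct)
  case less
  show ?case
  proof (cases "lin_dep_family z N")
    case False
    then show ?thesis
      using less.prems by blast
  next
    case True
    then obtain \<gamma>' j' where \<gamma>': "j' \<in> N" "\<gamma>' j' \<noteq> 0" "(\<Sum>i\<in>N. \<gamma>' i *\<^sub>R z i) = 0"
      by (auto simp: lin_dep_family_def)
    \<comment> \<open>Multiplying by the sign of a nonzero coefficient makes that coefficient
      positive, so the minimum below is over a nonempty set.\<close>
    define \<gamma> where "\<gamma> i = \<gamma>' i * sgn (\<gamma>' j')" for i
    have \<gamma>0: "(\<Sum>i\<in>N. \<gamma> i *\<^sub>R z i) = 0"
    proof -
      have "(\<Sum>i\<in>N. \<gamma> i *\<^sub>R z i) = sgn (\<gamma>' j') *\<^sub>R (\<Sum>i\<in>N. \<gamma>' i *\<^sub>R z i)"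
        by (simp add: \<gamma>_def scaleR_sum_right mult.commute)
      then show ?thesis
        using \<gamma>' by simp
    qed
    have "\<gamma> j' > 0"
      using \<gamma>' by (simp add: \<gamma>_def sgn_if)
    then have Pne: "{i\<in>N. \<gamma> i > 0} \<noteq> {}"
      using \<gamma>' by blast
    have fin: "finite {i\<in>N. \<gamma> i > 0}"
      using less.prems by simp
    \<comment> \<open>Ratio test: the longest step along the dependence that keeps all coefficients
      nonnegative.\<close>
    define t where "t = Min ((\<lambda>i. \<alpha> i / \<gamma> i) ` {i\<in>N. \<gamma> i > 0})"
    have "t \<in> (\<lambda>i. \<alpha> i / \<gamma> i) ` {i\<in>N. \<gamma> i > 0}"
      unfolding t_def using Pne fin by (intro Min_in) auto
    then obtain j where j: "j \<in> N" "\<gamma> j > 0" "t = \<alpha> j / \<gamma> j" by blast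
    have tpos: "t > 0"
      using j less.prems by simp
    have tle: "t * \<gamma> i \<le> \<alpha> i" if "i \<in> N" for i
    proof (cases "\<gamma> i > 0")
      case True
      then have "t \<le> \<alpha> i / \<gamma> i"
        unfolding t_def using that fin by (intro Min_le) auto
      then show ?thesis
        using True by (simp add: field_simps)
    next
      case False
      then have "t * \<gamma> i \<le> 0"
        using tpos by (simp add: mult_nonneg_nonpos)
      then show ?thesis
        using less.prems(2)[OF that] by linarith
    qed
    define \<alpha>' where "\<alpha>' i = \<alpha> i - t * \<gamma> i" for i
    \<comment> \<open>Several coefficients may vanish at once, so exactly the positive ones are
      kept.\<close>
    define N' where "N' = {i\<in>N. \<alpha>' i > 0}"
    have "\<alpha>' j = 0"
      using j by (simp add: \<alpha>'_def)
    then have "j \<notin> N'"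
      by (simp add: N'_def)
    then have "N' \<subset> N"
      using j(1) by (auto simp: N'_def)
    then have "card N' < card N"
      using less.prems(1) by (rule psubset_card_mono[rotated])
    moreover have "finite N'"
      using less.prems(1) by (simp add: N'_def)
    moreover have "0 < \<alpha>' i" if "i \<in> N'" for i
      using that by (simp add: N'_def)
    ultimately have "\<exists>J \<beta>. J \<subseteq> N' \<and> (\<forall>i\<in>J. 0 < \<beta> i) \<and>
        (\<Sum>i\<in>J. \<beta> i *\<^sub>R z i) = (\<Sum>i\<in>N'. \<alpha>' i *\<^sub>R z i) \<and> \<not> lin_dep_family z J"
      by (rule less.hyps)
    then obtain J \<beta> where J: "J \<subseteq> N'" "\<forall>i\<in>J. 0 < \<beta> i"
      "(\<Sum>i\<in>J. \<beta> i *\<^sub>R z i) = (\<Sum>i\<in>N'. \<alpha>' i *\<^sub>R z i)" "\<not> lin_dep_family z J"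
      by blast
    have "(\<Sum>i\<in>N'. \<alpha>' i *\<^sub>R z i) = (\<Sum>i\<in>N. \<alpha>' i *\<^sub>R z i)"
    proof (rule sum.mono_neutral_left)
      show "\<forall>i\<in>N - N'. \<alpha>' i *\<^sub>R z i = 0"
        using tle by (force simp: N'_def \<alpha>'_def)
    qed (use less.prems in \<open>auto simp: N'_def\<close>)
    also have "\<dots> = (\<Sum>i\<in>N. \<alpha> i *\<^sub>R z i) - t *\<^sub>R (\<Sum>i\<in>N. \<gamma> i *\<^sub>R z i)"
      by (simp add: \<alpha>'_def scaleR_left_diff_distrib sum_subtractf scaleR_sum_right)
    finally show ?thesis
      using J \<gamma>0 \<open>N' \<subset> N\<close> by (intro exI[of _ J] exI[of _ \<beta>]) auto
  qed
qed

section \<open>Boundedness and limits of multipliers\<close>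

text \<open>Bolzano-Weierstrass for one index at a time; passing to a further subsequence preserves
  the limits already obtained.\<close>

lemma bounded_family_convergent_subseq:
  fixes \<beta> :: "nat \<Rightarrow> nat \<Rightarrow> real"
  assumes "finite J" "\<And>i k. i \<in> J \<Longrightarrow> \<bar>\<beta> k i\<bar> \<le> c"
  shows "\<exists>s l. strict_mono s \<and> (\<forall>i\<in>J. (\<lambda>k. \<beta> (s k) i) \<longlonglongrightarrow> l i)"
  using assms
proof (induction J rule: finite_induct)
  case empty
  show ?case
    using strict_mono_id by blast
next
  case (insert j J)
  then obtain s l where s: "strict_mono s" "\<forall>i\<in>J. (\<lambda>k. \<beta> (s k) i) \<longlonglongrightarrow> l i"
    by auto
  have "bounded (range (\<lambda>k. \<beta> (s k) j))"
    using insert.prems[of j] by (auto intro!: boundedI)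
  then obtain a s' where s': "strict_mono s'" "((\<lambda>k. \<beta> (s k) j) \<circ> s') \<longlonglongrightarrow> a"
    using bounded_imp_convergent_subsequence by blast
  have "(\<lambda>k. \<beta> ((s \<circ> s') k) i) \<longlonglongrightarrow> (l(j := a)) i" if "i \<in> insert j J" for i
  proof (cases "i = j")
    case False
    then show ?thesis
      using that s(2) LIMSEQ_subseq_LIMSEQ[OF _ s'(1), of "\<lambda>k. \<beta> (s k) i" "l i"] by (auto simp: o_def)
  qed (use s'(2) in \<open>simp add: o_def\<close>)
  then show ?case
    using strict_mono_o[OF s(1) s'(1)] by blast
qed

text \<open>The limit argument for abstract vectors: \<open>v k\<close> stands for the constraint
  vectors along the sequence, \<open>g\<close> for the gradients and \<open>\<alpha>\<close> for the
  penalty multipliers. The last conclusion records which indices carry a limit multiplier;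
  complementarity will follow from it.\<close>

lemma CPLD_limit_multipliers:
  fixes v :: "nat \<Rightarrow> nat \<Rightarrow> 'a::real_normed_vector"
  assumes N: "finite N"
    and v: "\<And>i. i \<in> N \<Longrightarrow> (\<lambda>k. v k i) \<longlonglongrightarrow> w i"
    and g: "g \<longlonglongrightarrow> h"
    and \<alpha>: "\<And>k i. i \<in> N \<Longrightarrow> 0 \<le> \<alpha> k i"
    and lim: "(\<lambda>k. g k - (\<Sum>i\<in>N. \<alpha> k i *\<^sub>R v k i)) \<longlonglongrightarrow> 0"
    and CPLD: "\<And>J. J \<subseteq> N \<Longrightarrow> pos_lin_dep_family w J \<Longrightarrow> \<forall>\<^sub>F k in sequentially. lin_dep_family (v k) J"
  obtains \<beta> where "\<And>i. i \<in> N \<Longrightarrow> 0 \<le> \<beta> i" "h = (\<Sum>i\<in>N. \<beta> i *\<^sub>R w i)"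
    "\<And>i. i \<in> N \<Longrightarrow> \<beta> i \<noteq> 0 \<Longrightarrow> \<exists>\<^sub>F k in sequentially. \<alpha> k i > 0"
proof -
  have "\<exists>J \<beta>. J \<subseteq> {i\<in>N. \<alpha> k i > 0} \<and> (\<forall>i\<in>J. 0 < \<beta> i) \<and>
      (\<Sum>i\<in>J. \<beta> i *\<^sub>R v k i) = (\<Sum>i\<in>{i\<in>N. \<alpha> k i > 0}. \<alpha> k i *\<^sub>R v k i) \<and> \<not> lin_dep_family (v k) J" for k
    using N by (intro conic_Caratheodory) auto
  then obtain Js \<beta> where Js: "\<And>k. Js k \<subseteq> {i\<in>N. \<alpha> k i > 0}" and \<beta>pos: "\<And>k i. i \<in> Js k \<Longrightarrow> 0 < \<beta> k i"
    and eq: "\<And>k. (\<Sum>i\<in>Js k. \<beta> k i *\<^sub>R v k i) = (\<Sum>i\<in>{i\<in>N. \<alpha> k i > 0}. \<alpha> k i *\<^sub>R v k i)"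
    and indep: "\<And>k. \<not> lin_dep_family (v k) (Js k)"
    by metis
  have eqN: "(\<Sum>i\<in>{i\<in>N. \<alpha> k i > 0}. \<alpha> k i *\<^sub>R v k i) = (\<Sum>i\<in>N. \<alpha> k i *\<^sub>R v k i)" for k
  proof (rule sum.mono_neutral_left)
    show "\<forall>i\<in>N - {i \<in> N. 0 < \<alpha> k i}. \<alpha> k i *\<^sub>R v k i = 0"
      using \<alpha>[of _ k] by fastforce
  qed (use N in auto)
  have "range Js \<subseteq> Pow N"
    using Js by blast
  then have "finite (range Js)"
    using N finite_subset by blast
  \<comment> \<open>\<open>N\<close> has finitely many subsets, so one independent index set recurs
    infinitely often; the subsequence \<open>s\<close> follows it.\<close>
  then obtain J where J: "infinite {k. Js k = J}"
    using pigeonhole_infinite[of UNIV Js] by (auto simp: vimage_def)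
  define s where "s = enumerate {k. Js k = J}"
  have s: "strict_mono s" and sJ: "Js (s k) = J" for k
    using J strict_mono_enumerate[OF J] enumerate_in_set[OF J, of k] by (auto simp: s_def)
  have JN: "J \<subseteq> N"
    using Js[of "s 0"] sJ by blast
  then have finJ: "finite J"
    using N finite_subset by blast
  have vs: "(\<lambda>k. v (s k) i) \<longlonglongrightarrow> w i" if "i \<in> J" for i
    using LIMSEQ_subseq_LIMSEQ[OF v s] that JN by (auto simp: o_def)
  have sumlim: "(\<lambda>k. \<Sum>i\<in>J. \<beta> (s k) i *\<^sub>R v (s k) i) \<longlonglongrightarrow> h"
  proof -
    have "(\<lambda>k. \<Sum>i\<in>N. \<alpha> k i *\<^sub>R v k i) \<longlonglongrightarrow> h"
      using tendsto_diff[OF g lim] by simp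
    from LIMSEQ_subseq_LIMSEQ[OF this s] show ?thesis
      using eq[of "s _"] by (simp add: eqN sJ o_def)
  qed
  define S where "S k = (\<Sum>i\<in>J. \<beta> (s k) i)" for k
  have \<beta>J: "0 < \<beta> (s k) i" if "i \<in> J" for k i
    using \<beta>pos that sJ by blast
  have \<beta>S: "\<beta> (s k) i \<le> S k" if "i \<in> J" for k i
    unfolding S_def using that finJ \<beta>J by (intro member_le_sum) (auto intro: less_imp_le)
  have Snonneg: "0 \<le> S k" for k
    unfolding S_def using \<beta>J by (intro sum_nonneg) (auto intro: less_imp_le)
  \<comment> \<open>If the multipliers were unbounded, normalising them by their sum would give a positive linear
    dependence of the limit vectors over \<open>J\<close>, although the approximating families over \<open>J\<close> are
    linearly independent.\<close>
  have "\<not> filterlim S at_top sequentially"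
  proof
    assume S: "filterlim S at_top sequentially"
    define \<delta> where "\<delta> k i = \<beta> (s k) i / S k" for k i
    have \<delta>0: "0 \<le> \<delta> k i" if "i \<in> J" for k i
      using that \<beta>J[OF that] Snonneg by (simp add: \<delta>_def less_imp_le)
    have "\<bar>\<delta> k i\<bar> \<le> 1" if "i \<in> J" for k i
      using \<delta>0[OF that] \<beta>S[OF that] \<beta>J[OF that] Snonneg[of k]
      by (auto simp: \<delta>_def divide_le_eq_1 less_imp_le abs_of_nonneg)
    then obtain t l where t: "strict_mono t" "\<forall>i\<in>J. (\<lambda>k. \<delta> (t k) i) \<longlonglongrightarrow> l i"
      using bounded_family_convergent_subseq[OF finJ, of \<delta> 1] by blast
    have l0: "0 \<le> l i" if "i \<in> J" for i
      using t(2) that \<delta>0[OF that] by (intro LIMSEQ_le_const[of "\<lambda>k. \<delta> (t k) i"]) auto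
    have St: "filterlim (\<lambda>k. S (t k)) at_top sequentially"
      using filterlim_compose[OF S filterlim_subseq[OF t(1)]] .
    have suml: "(\<lambda>k. \<Sum>i\<in>J. \<delta> (t k) i) \<longlonglongrightarrow> (\<Sum>i\<in>J. l i)"
      using t(2) by (intro tendsto_sum) auto
    \<comment> \<open>The normalised multipliers eventually sum to 1, so their limits cannot all
      vanish.\<close>
    have "\<forall>\<^sub>F k in sequentially. (\<Sum>i\<in>J. \<delta> (t k) i) = 1"
      using filterlim_at_top_dense[THEN iffD1, OF St, rule_format, of 0]
      by eventually_elim (simp add: \<delta>_def S_def flip: sum_divide_distrib)
    from LIMSEQ_unique[OF suml tendsto_eventually[OF this]] have "(\<Sum>i\<in>J. l i) = 1" .
    then have "\<exists>i\<in>J. l i \<noteq> 0"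
      by (metis sum.neutral zero_neq_one)
    moreover have "(\<Sum>i\<in>J. l i *\<^sub>R w i) = 0"
    proof -
      have "(\<lambda>k. \<Sum>i\<in>J. \<delta> (t k) i *\<^sub>R v (s (t k)) i) \<longlonglongrightarrow> (\<Sum>i\<in>J. l i *\<^sub>R w i)"
        using t(2) LIMSEQ_subseq_LIMSEQ[OF vs t(1)] by (intro tendsto_sum tendsto_scaleR) (auto simp: o_def)
      \<comment> \<open>The sums before normalisation converge to \<open>h\<close>, so division by
        the diverging \<open>S\<close> sends them to 0.\<close>
      moreover have "(\<lambda>k. inverse (S (t k)) *\<^sub>R (\<Sum>i\<in>J. \<beta> (s (t k)) i *\<^sub>R v (s (t k)) i)) \<longlonglongrightarrow> 0 *\<^sub>R h"
        using LIMSEQ_subseq_LIMSEQ[OF sumlim t(1)] tendsto_inverse_0_at_top[OF St]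
        by (intro tendsto_scaleR) (auto simp: o_def)
      ultimately show ?thesis
        by (auto simp: \<delta>_def scaleR_sum_right divide_inverse mult.commute dest: LIMSEQ_unique)
    qed
    ultimately have "pos_lin_dep_family w J"
      using l0 by (auto simp: pos_lin_dep_family_def)
    then have "\<forall>\<^sub>F k in sequentially. lin_dep_family (v (s k)) J"
      using CPLD[OF JN] eventually_subseq[OF s] by blast
    then obtain k where "lin_dep_family (v (s k)) J"
      using eventually_happens' sequentially_bot by blast
    then show False
      using indep[of "s k"] sJ by simp
  qed
  \<comment> \<open>A sequence that does not tend to infinity stays below some \<open>C\<close> at
    infinitely many indices, and boundedness along such a subsequence suffices.\<close>
  then obtain C where C: "\<exists>\<^sub>F k in sequentially. S k < C"
    by (auto simp: filterlim_at_top frequently_def linorder_not_less)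
  then have inf: "infinite {k. S k < C}"
    by (simp add: frequently_cofinite flip: cofinite_eq_sequentially)
  define p where "p = enumerate {k. S k < C}"
  have p: "strict_mono p" and pC: "S (p k) < C" for k
    using inf strict_mono_enumerate[OF inf] enumerate_in_set[OF inf, of k] by (auto simp: p_def)
  have "\<bar>\<beta> (s (p k)) i\<bar> \<le> C" if "i \<in> J" for k i
    using \<beta>J[OF that, of "p k"] \<beta>S[OF that, of "p k"] pC[of k] by linarith
  then obtain q l where q: "strict_mono q" "\<forall>i\<in>J. (\<lambda>k. \<beta> (s (p (q k))) i) \<longlonglongrightarrow> l i"
    using bounded_family_convergent_subseq[OF finJ, of "\<lambda>k. \<beta> (s (p k))" C] by blast
  have pq: "strict_mono (p \<circ> q)"
    using strict_mono_o[OF p q(1)] .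
  have l0: "0 \<le> l i" if "i \<in> J" for i
    using q(2) that \<beta>J[OF that]
    by (intro LIMSEQ_le_const[of "\<lambda>k. \<beta> (s (p (q k))) i"]) (auto intro: less_imp_le)
  have "(\<lambda>k. \<Sum>i\<in>J. \<beta> (s (p (q k))) i *\<^sub>R v (s (p (q k))) i) \<longlonglongrightarrow> (\<Sum>i\<in>J. l i *\<^sub>R w i)"
    using q(2) LIMSEQ_subseq_LIMSEQ[OF vs pq] by (intro tendsto_sum tendsto_scaleR) (auto simp: o_def)
  moreover have "(\<lambda>k. \<Sum>i\<in>J. \<beta> (s (p (q k))) i *\<^sub>R v (s (p (q k))) i) \<longlonglongrightarrow> h"
    using LIMSEQ_subseq_LIMSEQ[OF sumlim pq] by (simp add: o_def)
  ultimately have h: "h = (\<Sum>i\<in>J. l i *\<^sub>R w i)"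
    using LIMSEQ_unique by blast
  show thesis
  \<comment> \<open>Extension by 0 outside \<open>J\<close>: a nonzero value forces the index into
    \<open>J\<close>, where \<open>\<alpha>\<close> is positive all along \<open>s\<close>.\<close>
  proof (rule that[of "\<lambda>i. if i \<in> J then l i else 0"])
    show "h = (\<Sum>i\<in>N. (if i \<in> J then l i else 0) *\<^sub>R w i)"
      unfolding h using N JN by (intro sum.mono_neutral_cong_left) auto
    fix i assume "(if i \<in> J then l i else 0) \<noteq> 0"
    then have "i \<in> J" by (auto split: if_splits)
    then have "\<alpha> (s k) i > 0" for k
      using Js[of "s k"] sJ by blast
    then show "\<exists>\<^sub>F k in sequentially. \<alpha> k i > 0"
      using s by (metis (mono_tags, lifting) frequently_sequentially seq_suble)
  qed (use l0 in auto)
qed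

section \<open>Gradients of the Lagrangian\<close>

lemma C1_differentiable: "C1 f \<Longrightarrow> f differentiable at x"
  by (auto simp: C1_def differentiable_def)

lemma has_derivative_inner_self:
  assumes "(g has_derivative g') (at x)"
  shows "((\<lambda>y. g y \<bullet> g y) has_derivative (\<lambda>h. 2 * (g x \<bullet> g' h))) (at x)"
  using has_derivative_inner[OF assms assms] by (simp add: inner_commute)

lemma inner_gradient:
  fixes f :: "'a::euclidean_space \<Rightarrow> real"
  assumes "(f has_derivative f') (at x)"
  shows "gradient f x \<bullet> h = f' h"
proof -
  have lin: "linear f'"
    using assms by (rule has_derivative_linear)
  have "f' = (\<lambda>h. h \<bullet> adjoint f' 1)"
    using adjoint_works[OF lin, of _ 1] by (simp add: fun_eq_iff)
  then have "GDERIV f x :> adjoint f' 1"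
    using assms by (simp add: gderiv_def)
  then show ?thesis
    using \<open>f' = (\<lambda>h. h \<bullet> adjoint f' 1)\<close> by (metis gradient_eqI inner_commute)
qed

lemma tendsto_gradient:
  fixes f :: "'a::euclidean_space \<Rightarrow> real"
  assumes "C1 f" "(x \<longlongrightarrow> l) F"
  shows "((\<lambda>k. gradient f (x k)) \<longlongrightarrow> gradient f l) F"
proof -
  obtain f' :: "'a \<Rightarrow> 'a \<Rightarrow>\<^sub>L real" where
    f': "\<And>x. (f has_derivative blinfun_apply (f' x)) (at x)" "continuous_on UNIV f'"
    using assms(1) by (auto simp: C1_def)
  have "((\<lambda>k. f' (x k)) \<longlongrightarrow> f' l) F"
    using f'(2) assms(2) by (simp add: continuous_on_tendsto_compose)
  then have "((\<lambda>k. \<Sum>b\<in>Basis. f' (x k) b *\<^sub>R b) \<longlongrightarrow> (\<Sum>b\<in>Basis. f' l b *\<^sub>R b)) F"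
    by (intro tendsto_intros)
  moreover have "gradient f y = (\<Sum>b\<in>Basis. f' y b *\<^sub>R b)" for y
    using euclidean_representation[of "gradient f y"] by (simp add: inner_gradient[OF f'(1)])
  ultimately show ?thesis by simp
qed

lemma tendsto_partial_deriv:
  fixes G :: "real ^ 'n \<Rightarrow> 'b::euclidean_space"
  assumes "C1 G" "(x \<longlongrightarrow> l) F"
  shows "((\<lambda>k. partial_deriv G i (x k)) \<longlongrightarrow> partial_deriv G i l) F"
proof -
  obtain G' :: "real ^ 'n \<Rightarrow> (real ^ 'n) \<Rightarrow>\<^sub>L 'b" where
    G': "\<And>x. (G has_derivative blinfun_apply (G' x)) (at x)" "continuous_on UNIV G'"
    using assms(1) by (auto simp: C1_def)
  have "((\<lambda>k. G' (x k)) \<longlongrightarrow> G' l) F"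
    using G'(2) assms(2) by (simp add: continuous_on_tendsto_compose)
  then have "((\<lambda>k. G' (x k) (axis i 1)) \<longlongrightarrow> G' l (axis i 1)) F"
    by (intro tendsto_intros)
  moreover have "partial_deriv G i y = G' y (axis i 1)" for y
    using frechet_derivative_at[OF G'(1)[of y]] by (simp add: partial_deriv_def)
  ultimately show ?thesis by simp
qed

lemma diag_vec_nth: "diag_vec G x E i $ l = partial_deriv G l x \<bullet> outer (E i)"
  by (simp add: diag_vec_def inner_outer)

lemma tendsto_diag_vec:
  assumes "C1 G" "(x \<longlongrightarrow> l) F" "((\<lambda>k. E k i) \<longlongrightarrow> Ebar i) F"
  shows "((\<lambda>k. diag_vec G (x k) (E k) i) \<longlongrightarrow> diag_vec G l Ebar i) F"
  by (rule vec_tendstoI) (unfold diag_vec_nth, intro tendsto_intros tendsto_partial_deriv assms)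

text \<open>The adjoint of DG sends each u u^T to the corresponding vector of quadratic forms, see
  \<open>diag_vec_nth\<close>. This translates matrix multipliers into the vectors that weak-CPLD
  speaks of.\<close>

lemma grad_lagrangian_outer:
  fixes G :: "real ^ 'n \<Rightarrow> real ^ 'm ^ 'm"
  assumes f: "f differentiable at x" and G: "G differentiable at x"
  shows "grad_lagrangian f G x (\<Sum>i\<in>I. a i *\<^sub>R outer (E i)) =
    gradient f x - (\<Sum>i\<in>I. a i *\<^sub>R diag_vec G x E i)"
proof -
  let ?Y = "\<Sum>i\<in>I. a i *\<^sub>R outer (E i)"
  have "(\<Sum>i\<in>I. a i *\<^sub>R outer (E i)) \<in> sym_mats"
    by (intro subspace_sum sym_mats_subspace sym_mats_closed_ops outer_sym)
  then have "grad_lagrangian f G x ?Y = gradient f x - adjoint (frechet_derivative G (at x)) ?Y"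
    by (rule grad_lagrangian_eq[OF f G])
  moreover have "adjoint (frechet_derivative G (at x)) ?Y $ l = (\<Sum>i\<in>I. a i *\<^sub>R diag_vec G x E i) $ l" for l
  proof -
    have "linear (frechet_derivative G (at x))"
      using G by (rule linear_frechet_derivative)
    from adjoint_works[OF this, of "axis l 1" ?Y]
    have "adjoint (frechet_derivative G (at x)) ?Y $ l = partial_deriv G l x \<bullet> ?Y"
      by (simp add: inner_axis' partial_deriv_def)
    then show ?thesis
      by (simp add: inner_sum_right diag_vec_nth)
  qed
  ultimately show ?thesis
    by (simp add: vec_eq_iff)
qed

section \<open>Penalty sequences and the KKT conditions\<close>

text \<open>Convergence along \<open>I\<close> becomes convergence along its enumeration, and the
  full-rank alternative is absorbed, so that later arguments need no case distinction.\<close>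

lemma weak_CPLD_sequence:
  fixes G :: "real ^ 'n \<Rightarrow> real ^ 'm ^ 'm"
  assumes "weak_CPLD G xbar" "x \<longlonglongrightarrow> xbar"
  defines "r \<equiv> rank (G xbar)"
  obtains s E Ebar where "strict_mono (s :: nat \<Rightarrow> nat)"
    "\<And>k. E k \<in> eigvec_mats r (G (x (s k)))"
    "\<And>i. i \<in> {1..CARD('m) - r} \<Longrightarrow> (\<lambda>k. E k i) \<longlonglongrightarrow> Ebar i"
    "\<And>J. J \<subseteq> {1..CARD('m) - r} \<Longrightarrow> pos_lin_dep_family (diag_vec G xbar Ebar) J \<Longrightarrow>
       \<forall>\<^sub>F k in sequentially. lin_dep_family (diag_vec G (x (s k)) (E k)) J"
proof (cases "r = CARD('m)")
  case True
  show thesis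
  \<comment> \<open>At full rank there are no columns, so dummy values serve; only the empty
    \<open>J\<close> remains, and it is not positively dependent.\<close>
  proof (rule that[of id "\<lambda>k i. 0" "\<lambda>i. 0"])
    fix J assume "J \<subseteq> {1..CARD('m) - r}" "pos_lin_dep_family (diag_vec G xbar (\<lambda>i. 0)) J"
    then show "\<forall>\<^sub>F k in sequentially. lin_dep_family (diag_vec G (x (id k)) (\<lambda>i. 0)) J"
      using True by (auto simp: pos_lin_dep_family_def)
  qed (use True in \<open>auto simp: eigvec_mats_def strict_mono_id\<close>)
next
  case False
  then have "\<exists>I E Ebar. infinite I \<and>
           (\<forall>k\<in>I. E k \<in> eigvec_mats r (G (x k))) \<and>
           (\<forall>i\<in>{1..CARD('m) - r}.
              ((\<lambda>k. E k i) \<longlongrightarrow> Ebar i) (inf sequentially (principal I))) \<and>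
           (\<forall>J \<subseteq> {1..CARD('m) - r}.
              pos_lin_dep_family (diag_vec G xbar Ebar) J \<longrightarrow>
              (\<forall>\<^sub>F k in inf sequentially (principal I).
                 lin_dep_family (diag_vec G (x k) (E k)) J))"
    using assms(1,2) unfolding weak_CPLD_def Let_def r_def by blast
  then obtain I E Ebar where I: "infinite I"
    and E: "\<forall>k\<in>I. E k \<in> eigvec_mats r (G (x k))"
    and lim: "\<forall>i\<in>{1..CARD('m) - r}. ((\<lambda>k. E k i) \<longlongrightarrow> Ebar i) (inf sequentially (principal I))"
    and dep: "\<forall>J \<subseteq> {1..CARD('m) - r}. pos_lin_dep_family (diag_vec G xbar Ebar) J \<longrightarrow>
      (\<forall>\<^sub>F k in inf sequentially (principal I). lin_dep_family (diag_vec G (x k) (E k)) J)"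
    by blast
  have s: "strict_mono (enumerate I)"
    using I by (rule strict_mono_enumerate)
  have sI: "enumerate I k \<in> I" for k
    using I by (rule enumerate_in_set)
  have fl: "filterlim (enumerate I) (inf sequentially (principal I)) sequentially"
    using filterlim_subseq[OF s] sI by (simp add: filterlim_inf filterlim_principal)
  show thesis
  proof (rule that[of "enumerate I" "\<lambda>k. E (enumerate I k)" Ebar])
    show "(\<lambda>k. E (enumerate I k) i) \<longlonglongrightarrow> Ebar i" if "i \<in> {1..CARD('m) - r}" for i
      using filterlim_compose[OF lim[rule_format, OF that] fl] .
    show "\<forall>\<^sub>F k in sequentially. lin_dep_family (diag_vec G (x (enumerate I k)) (E (enumerate I k))) J"
      if "J \<subseteq> {1..CARD('m) - r}" "pos_lin_dep_family (diag_vec G xbar Ebar) J" for J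
      using dep that fl by (auto simp: filterlim_iff)
  qed (use s sI E in auto)
qed

text \<open>The multiplier is assembled from the limit coefficients and the limit eigenvectors as a
  sum of rank-one matrices, so semidefiniteness is immediate and complementarity can be checked
  summand by summand.\<close>

lemma KKT_of_penalty_sequence:
  fixes f :: "real ^ 'n \<Rightarrow> real" and G :: "real ^ 'n \<Rightarrow> real ^ 'm ^ 'm"
  assumes f: "C1 f" and G: "C1 G" and sym: "range G \<subseteq> sym_mats"
    and \<rho>: "\<And>k. 0 < \<rho> k" and x: "x \<longlonglongrightarrow> xbar"
    and grad: "(\<lambda>k. grad_lagrangian f G (x k) (\<rho> k *\<^sub>R proj_psd (- G (x k)))) \<longlonglongrightarrow> 0"
    and CPLD: "weak_CPLD G xbar"
  shows "KKT f G xbar"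
proof -
  define r where "r = rank (G xbar)"
  define I where "I = {1..CARD('m) - r}"
  have r: "r \<le> CARD('m)"
    using rank_bound[of "G xbar"] by (simp add: r_def)
  have feas: "xbar \<in> feasible G" and psd: "G xbar \<in> psd_cone"
    using CPLD by (auto simp: weak_CPLD_def feasible_def)
  have symG: "G y \<in> sym_mats" for y
    using sym by blast
  obtain s E Ebar where s: "strict_mono (s :: nat \<Rightarrow> nat)"
    and E: "\<And>k. E k \<in> eigvec_mats r (G (x (s k)))"
    and Ebar: "\<And>i. i \<in> I \<Longrightarrow> (\<lambda>k. E k i) \<longlonglongrightarrow> Ebar i"
    and dep: "\<And>J. J \<subseteq> I \<Longrightarrow> pos_lin_dep_family (diag_vec G xbar Ebar) J \<Longrightarrow>
       \<forall>\<^sub>F k in sequentially. lin_dep_family (diag_vec G (x (s k)) (E k)) J"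
    using weak_CPLD_sequence[OF CPLD x] unfolding r_def I_def by blast
  have xs: "(\<lambda>k. x (s k)) \<longlonglongrightarrow> xbar"
    using LIMSEQ_subseq_LIMSEQ[OF x s] by (simp add: o_def)
  have Gs: "(\<lambda>k. G (x (s k))) \<longlonglongrightarrow> G xbar"
    using differentiable_imp_continuous_within[OF C1_differentiable[OF G]] xs
    by (rule isCont_tendsto_compose)
  \<comment> \<open>The coefficients of the penalty multiplier in the rank-one matrices of the
    columns, as given by \<open>proj_psd_eigvec_mats\<close>.\<close>
  define \<alpha> where "\<alpha> k i = \<rho> (s k) * max 0 (- eigval (G (x (s k))) (r + i))" for k i
  have proj: "\<forall>\<^sub>F k in sequentially. grad_lagrangian f G (x (s k)) (\<rho> (s k) *\<^sub>R proj_psd (- G (x (s k)))) =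
      gradient f (x (s k)) - (\<Sum>i\<in>I. \<alpha> k i *\<^sub>R diag_vec G (x (s k)) (E k) i)"
    using psd_pos_on_range[OF psd Gs]
  proof eventually_elim
    case (elim k)
    have "proj_psd (- G (x (s k))) = (\<Sum>i\<in>I. max 0 (- eigval (G (x (s k))) (r + i)) *\<^sub>R outer (E k i))"
      unfolding I_def
    proof (rule proj_psd_eigvec_mats[OF symG r E])
      show "subspace (range ((*v) (G xbar)))"
        by (rule linear_subspace_image[OF matrix_vector_mul_linear subspace_UNIV])
      show "dim (range ((*v) (G xbar))) = r"
        by (simp add: r_def rank_dim_range)
    qed (use elim in blast)
    then have "\<rho> (s k) *\<^sub>R proj_psd (- G (x (s k))) = (\<Sum>i\<in>I. \<alpha> k i *\<^sub>R outer (E k i))"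
      by (simp add: \<alpha>_def scaleR_sum_right)
    then show ?case
      by (simp add: grad_lagrangian_outer C1_differentiable f G)
  qed
  have lim0: "(\<lambda>k. gradient f (x (s k)) - (\<Sum>i\<in>I. \<alpha> k i *\<^sub>R diag_vec G (x (s k)) (E k) i)) \<longlonglongrightarrow> 0"
    using LIMSEQ_subseq_LIMSEQ[OF grad s] by (rule Lim_transform_eventually) (use proj in \<open>simp add: o_def\<close>)
  have lima: "(\<lambda>k. diag_vec G (x (s k)) (E k) i) \<longlonglongrightarrow> diag_vec G xbar Ebar i" if "i \<in> I" for i
    using G xs Ebar[OF that] by (rule tendsto_diag_vec)
  have \<alpha>0: "0 \<le> \<alpha> k i" for k i
    using \<rho>[of "s k"] by (simp add: \<alpha>_def)
  have finI: "finite I"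
    by (simp add: I_def)
  obtain \<beta> where \<beta>: "\<And>i. i \<in> I \<Longrightarrow> 0 \<le> \<beta> i" "gradient f xbar = (\<Sum>i\<in>I. \<beta> i *\<^sub>R diag_vec G xbar Ebar i)"
    and freq: "\<And>i. i \<in> I \<Longrightarrow> \<beta> i \<noteq> 0 \<Longrightarrow> \<exists>\<^sub>F k in sequentially. \<alpha> k i > 0"
    using CPLD_limit_multipliers[OF finI lima tendsto_gradient[OF f xs] \<alpha>0 lim0 dep] by blast
  let ?Y = "\<Sum>i\<in>I. \<beta> i *\<^sub>R outer (Ebar i)"
  have Y: "?Y \<in> psd_cone"
    using \<beta>(1) by (intro psd_sum psd_scaleR psd_outer)
  have compl: "\<beta> i * (G xbar \<bullet> outer (Ebar i)) = 0" if i: "i \<in> I" for i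
  proof (cases "\<beta> i = 0")
    case False
    have lim: "(\<lambda>k. G (x (s k)) \<bullet> outer (E k i)) \<longlonglongrightarrow> G xbar \<bullet> outer (Ebar i)"
      by (intro tendsto_intros Gs Ebar i)
    have eig: "G (x (s k)) \<bullet> outer (E k i) = eigval (G (x (s k))) (r + i)" for k
      using E[of k] i by (simp add: eigvec_mats_def inner_outer I_def)
    \<comment> \<open>A positive limit would make the eigenvalues
      \<open>eigval (G (x (s k))) (r + i)\<close> eventually positive and thus
      \<open>\<alpha> k i\<close> eventually 0, against \<open>freq\<close>.\<close>
    have "G xbar \<bullet> outer (Ebar i) \<le> 0"
    proof (rule ccontr)
      assume "\<not> G xbar \<bullet> outer (Ebar i) \<le> 0"
      then have "\<forall>\<^sub>F k in sequentially. 0 < G (x (s k)) \<bullet> outer (E k i)"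
        using order_tendstoD(1)[OF lim] by simp
      then have "\<forall>\<^sub>F k in sequentially. \<not> \<alpha> k i > 0"
        by eventually_elim (simp add: eig \<alpha>_def)
      then show False
        using freq[OF i False] by (simp add: frequently_def)
    qed
    moreover have "0 \<le> G xbar \<bullet> outer (Ebar i)"
      by (rule psd_inner_nonneg[OF psd psd_outer])
    ultimately show ?thesis by simp
  qed simp
  have "mat_inner (G xbar) ?Y = G xbar \<bullet> ?Y"
    using Y by (intro mat_inner_eq_inner) (simp add: psd_cone_def)
  also have "\<dots> = 0"
    unfolding inner_sum_right using compl by (intro sum.neutral) simp
  finally have "mat_inner (G xbar) ?Y = 0" .
  moreover have "grad_lagrangian f G xbar ?Y = 0"
    using \<beta>(2) by (simp add: grad_lagrangian_outer C1_differentiable f G)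
  ultimately show ?thesis
    using Y feas unfolding KKT_def by blast
qed

section \<open>Penalty sequences at local minimizers\<close>

text \<open>The proximity term of the penalty function forces its minimizers to converge to
  \<open>xbar\<close> itself. Stationarity of these minimizers identifies the gradient of the
  Lagrangian with the vanishing vector \<open>xbar - x k\<close>.\<close>

lemma local_minimizer_penalty_sequence:
  fixes f :: "real ^ 'n \<Rightarrow> real" and G :: "real ^ 'n \<Rightarrow> real ^ 'm ^ 'm"
  assumes f: "C1 f" and G: "C1 G" and sym: "range G \<subseteq> sym_mats"
    and min: "local_minimizer f (feasible G) xbar"
  obtains \<rho> x where "\<And>k :: nat. 0 < (\<rho> k :: real)" "x \<longlonglongrightarrow> xbar"
    "(\<lambda>k. grad_lagrangian f G (x k) (\<rho> k *\<^sub>R proj_psd (- G (x k)))) \<longlonglongrightarrow> 0"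
proof -
  obtain e where e: "e > 0" "\<And>y. y \<in> feasible G \<Longrightarrow> y \<in> ball xbar e \<Longrightarrow> f xbar \<le> f y"
    and feas: "xbar \<in> feasible G"
    using min unfolding local_minimizer_def by blast
  \<comment> \<open>Halving the radius gives a compact ball inside the open ball on which
    \<open>xbar\<close> is optimal.\<close>
  define C where "C = cball xbar (e / 2)"
  define d where "d y = norm (G y - proj_psd (G y))" for y
  \<comment> \<open>The weight k + 1 is positive already at k = 0, and the halves cancel on
    differentiation.\<close>
  define F where "F k y = f y + (norm (y - xbar))\<^sup>2 / 2 + (real k + 1) / 2 * (d y)\<^sup>2" for k y
  have contf: "continuous_on A f" for A
    by (meson C1_differentiable[OF f] continuous_at_imp_continuous_on differentiable_imp_continuous_within)
  have contG: "continuous_on A G" for A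
    by (meson C1_differentiable[OF G] continuous_at_imp_continuous_on differentiable_imp_continuous_within)
  have projK: "proj_psd M \<in> psd_cone" for M :: "real ^ 'm ^ 'm"
    unfolding proj_psd_def using psd_0 by (intro closest_point_in_set psd_closed) blast
  have contP: "continuous_on A (\<lambda>y. proj_psd (G y))" for A
    unfolding proj_psd_def using psd_0
    by (intro continuous_on_compose2[OF continuous_on_closest_point[OF psd_convex psd_closed] contG subset_UNIV]) blast
  have contd: "continuous_on A d" for A
    unfolding d_def by (intro continuous_intros contG contP)
  have d_le: "d y \<le> norm (G y - Q)" if "Q \<in> psd_cone" for y Q
    using closest_point_le[OF psd_closed that, of "G y"] by (simp add: d_def proj_psd_def dist_norm)
  have dbar: "d xbar = 0"
    using d_le[of "G xbar" xbar] feas by (simp add: feasible_def d_def)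
  have cpt: "compact C"
    by (simp add: C_def)
  have xC: "xbar \<in> C"
    using e by (simp add: C_def)
  have "\<exists>y\<in>C. \<forall>z\<in>C. F k y \<le> F k z" for k
    using xC unfolding F_def
    by (intro continuous_attains_inf cpt continuous_intros contf contd) auto
  then obtain u where uC: "\<And>k. u k \<in> C" and umin: "\<And>k z. z \<in> C \<Longrightarrow> F k (u k) \<le> F k z"
    by metis
  obtain l t where l: "l \<in> C" and t: "strict_mono (t :: nat \<Rightarrow> nat)" and ut: "(u \<circ> t) \<longlonglongrightarrow> l"
    using cpt uC unfolding compact_def by metis
  obtain c where c: "\<And>y. y \<in> C \<Longrightarrow> c \<le> f y"
    using continuous_attains_inf[OF cpt _ contf] xC by (metis empty_iff)
  have Fle: "F k (u k) \<le> f xbar" for k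
    using umin[OF xC, of k] dbar by (simp add: F_def)
  \<comment> \<open>The penalty vanishes at \<open>xbar\<close> and \<open>f\<close> is at least
    \<open>c\<close> on \<open>C\<close>, so comparing values with \<open>xbar\<close> makes the
    squared distance of order 1/k.\<close>
  have d2: "(d (u k))\<^sup>2 \<le> 2 * (f xbar - c) / (real k + 1)" for k
  proof -
    have "(real k + 1) / 2 * (d (u k))\<^sup>2 \<le> f xbar - c"
      using Fle[of k] c[OF uC, of k] unfolding F_def
      using zero_le_power2[of "norm (u k - xbar)"] by linarith
    then show ?thesis
      by (simp add: field_simps)
  qed
  have lim: "(\<lambda>k. u (t k)) \<longlonglongrightarrow> l"
    using ut by (simp add: o_def)
  have dlim: "(\<lambda>k. (d (u (t k)))\<^sup>2) \<longlonglongrightarrow> (d l)\<^sup>2"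
    using continuous_on_tendsto_compose[OF contd[of UNIV] lim] by (intro tendsto_intros) simp
  have "(\<lambda>k. 2 * (f xbar - c) / (real (t k) + 1)) \<longlonglongrightarrow> 0"
  proof -
    have "(\<lambda>k. 2 * (f xbar - c) / (real k + 1)) \<longlonglongrightarrow> 0"
      by real_asymp
    from LIMSEQ_subseq_LIMSEQ[OF this t] show ?thesis
      by (simp add: o_def)
  qed
  then have "(d l)\<^sup>2 \<le> 0"
    using dlim d2 by (intro LIMSEQ_le[OF dlim]) auto
  then have "G l = proj_psd (G l)"
    by (simp add: d_def)
  then have "l \<in> feasible G"
    using projK[of "G l"] by (simp add: feasible_def)
  then have fl: "f xbar \<le> f l"
    using l e by (intro e(2)) (auto simp: C_def)
  \<comment> \<open>With the penalty term dropped, the bound by \<open>f xbar\<close> passes to the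
    limit; as \<open>l\<close> is feasible, \<open>fl\<close> leaves no room for the proximity
    term.\<close>
  have "(\<lambda>k. f (u (t k)) + (norm (u (t k) - xbar))\<^sup>2 / 2) \<longlonglongrightarrow> f l + (norm (l - xbar))\<^sup>2 / 2"
    using continuous_on_tendsto_compose[OF contf[of UNIV] lim] lim by (intro tendsto_intros) auto
  moreover have "f (u (t k)) + (norm (u (t k) - xbar))\<^sup>2 / 2 \<le> f xbar" for k
  proof -
    have "0 \<le> (real (t k) + 1) / 2 * (d (u (t k)))\<^sup>2"
      by simp
    then show ?thesis
      using Fle[of "t k"] unfolding F_def by linarith
  qed
  ultimately have "f l + (norm (l - xbar))\<^sup>2 / 2 \<le> f xbar"
    by (intro LIMSEQ_le_const2) auto
  then have "(norm (l - xbar))\<^sup>2 \<le> 0"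
    using fl by linarith
  then have [simp]: "l = xbar" by simp
  define x where "x k = u (t k)" for k
  \<comment> \<open>Convergence is known along \<open>t\<close> only, so the parameter is the weight
    of the problem that \<open>x k\<close> solves.\<close>
  define \<rho> where "\<rho> k = real (t k) + 1" for k
  have x: "x \<longlonglongrightarrow> xbar"
    using lim by (simp add: x_def[abs_def])
  have "\<forall>\<^sub>F k in sequentially. x k \<in> ball xbar (e / 2)"
    using tendstoD[OF x, of "e / 2"] e by (simp add: dist_commute)
  then have "\<forall>\<^sub>F k in sequentially. xbar - x k = grad_lagrangian f G (x k) (\<rho> k *\<^sub>R proj_psd (- G (x k)))"
  proof eventually_elim
    case (elim k)
    obtain f' where f': "(f has_derivative f') (at (x k))"
      using C1_differentiable[OF f] unfolding differentiable_def by blast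
    let ?G' = "frechet_derivative G (at (x k))"
    have G': "(G has_derivative ?G') (at (x k))"
      using C1_differentiable[OF G] frechet_derivative_works by blast
    let ?Q = "proj_psd (G (x k))"
    \<comment> \<open>Freezing the projection at \<open>x k\<close> gives a differentiable majorant of the penalty function
      that agrees with it at \<open>x k\<close>; differentiability of the squared distance is not needed.\<close>
    define \<psi> where "\<psi> y = f y + 1 / 2 * ((y - xbar) \<bullet> (y - xbar)) + \<rho> k / 2 * ((G y - ?Q) \<bullet> (G y - ?Q))" for y
    have sq_x: "((\<lambda>y. (y - xbar) \<bullet> (y - xbar)) has_derivative (\<lambda>h. 2 * ((x k - xbar) \<bullet> h))) (at (x k))"
      by (rule has_derivative_inner_self) (auto intro!: derivative_eq_intros)
    have sq_G: "((\<lambda>y. (G y - ?Q) \<bullet> (G y - ?Q)) has_derivative (\<lambda>h. 2 * ((G (x k) - ?Q) \<bullet> ?G' h))) (at (x k))"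
      by (rule has_derivative_inner_self) (auto intro!: derivative_eq_intros G')
    have deriv: "(\<psi> has_derivative (\<lambda>h. f' h + (x k - xbar) \<bullet> h + \<rho> k * ((G (x k) - ?Q) \<bullet> ?G' h))) (at (x k))"
      using has_derivative_add[OF has_derivative_add[OF f' has_derivative_mult_right[OF sq_x, of "1 / 2"]]
          has_derivative_mult_right[OF sq_G, of "\<rho> k / 2"]]
      by (simp add: \<psi>_def[abs_def])
    have "\<psi> (x k) \<le> \<psi> y" if y: "y \<in> ball xbar (e / 2)" for y
    proof -
      have "\<psi> (x k) = F (t k) (x k)"
        by (simp add: \<psi>_def F_def d_def \<rho>_def power2_norm_eq_inner)
      also have "\<dots> \<le> F (t k) y"
        using y unfolding x_def by (intro umin) (auto simp: C_def)
      also have "\<dots> \<le> \<psi> y"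
      proof -
        have "(d y)\<^sup>2 \<le> (norm (G y - ?Q))\<^sup>2"
          using d_le[OF projK] by (intro power_mono) (auto simp: d_def)
        then have "\<rho> k / 2 * (d y)\<^sup>2 \<le> \<rho> k / 2 * (norm (G y - ?Q))\<^sup>2"
          by (intro mult_left_mono) (auto simp: \<rho>_def)
        then show ?thesis
          unfolding \<psi>_def F_def power2_norm_eq_inner by (simp add: \<rho>_def)
      qed
      finally show ?thesis .
    qed
    \<comment> \<open>\<open>x k\<close> lies in the open ball and minimizes \<open>\<psi>\<close>
      there, so the derivative vanishes.\<close>
    with elim deriv have "(\<lambda>h. f' h + (x k - xbar) \<bullet> h + \<rho> k * ((G (x k) - ?Q) \<bullet> ?G' h)) = (\<lambda>h. 0)"
      by (intro differential_zero_maxmin[of "x k" "ball xbar (e / 2)" \<psi>]) auto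
    then have zero: "f' h + (x k - xbar) \<bullet> h + \<rho> k * ((G (x k) - ?Q) \<bullet> ?G' h) = 0" for h
      by metis
    have symx: "G (x k) \<in> sym_mats"
      using sym by blast
    let ?Y = "\<rho> k *\<^sub>R proj_psd (- G (x k))"
    have "?Y \<in> sym_mats"
      using projK[of "- G (x k)"] by (simp add: psd_cone_def sym_mats_closed_ops)
    then have "grad_lagrangian f G (x k) ?Y = gradient f (x k) - adjoint ?G' ?Y"
      by (intro grad_lagrangian_eq C1_differentiable f G)
    then have "grad_lagrangian f G (x k) ?Y \<bullet> h = f' h - ?Y \<bullet> ?G' h" for h
      using adjoint_works[OF has_derivative_linear[OF G'], of h ?Y] inner_gradient[OF f', of h]
      by (simp add: inner_diff_right inner_commute[of _ h] inner_commute[of _ "?G' h"])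
    \<comment> \<open>By \<open>proj_psd_uminus\<close>, the residual \<open>G (x k) - ?Q\<close>
      equals \<open>- proj_psd (- G (x k))\<close>, so the third term of \<open>zero\<close> is the
      pairing of \<open>?G' h\<close> with \<open>- ?Y\<close>.\<close>
    also have "f' h - ?Y \<bullet> ?G' h = (xbar - x k) \<bullet> h" for h
      using zero[of h] by (simp add: proj_psd_uminus[OF symx] inner_simps algebra_simps)
    finally show ?case
      by (metis vector_eq_rdot)
  qed
  moreover have "(\<lambda>k. xbar - x k) \<longlonglongrightarrow> 0"
    using tendsto_diff[OF tendsto_const x, of xbar] by simp
  ultimately have "(\<lambda>k. grad_lagrangian f G (x k) (\<rho> k *\<^sub>R proj_psd (- G (x k)))) \<longlonglongrightarrow> 0"
    by (rule Lim_transform_eventually[rotated])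
  moreover have "0 < \<rho> k" for k
    by (simp add: \<rho>_def)
  ultimately show thesis
    using that x by blast
qed

theorem theorem3p1:
  fixes f :: "real ^ 'n \<Rightarrow> real"
    and G :: "real ^ 'n \<Rightarrow> real ^ 'm ^ 'm"
  assumes "C1 f" and "C1 G" and "range G \<subseteq> sym_mats"
  shows "(\<forall>(\<rho> :: nat \<Rightarrow> real) (x :: nat \<Rightarrow> real ^ 'n) xbar.
            (\<forall>k. 0 < \<rho> k) \<longrightarrow>
            filterlim \<rho> at_top sequentially \<longrightarrow>
            x \<longlonglongrightarrow> xbar \<longrightarrow>
            xbar \<in> feasible G \<longrightarrow>
            (\<lambda>k. grad_lagrangian f G (x k) (\<rho> k *\<^sub>R proj_psd (- G (x k)))) \<longlonglongrightarrow> 0 \<longrightarrow>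
            weak_CPLD G xbar \<longrightarrow>
            KKT f G xbar)
       \<and> (\<forall>xbar. local_minimizer f (feasible G) xbar \<longrightarrow> weak_CPLD G xbar \<longrightarrow> KKT f G xbar)"
proof (intro conjI allI impI)
  fix xbar
  assume "local_minimizer f (feasible G) xbar" and CPLD: "weak_CPLD G xbar"
  then obtain \<rho> x where "\<And>k :: nat. 0 < (\<rho> k :: real)" "x \<longlonglongrightarrow> xbar"
    "(\<lambda>k. grad_lagrangian f G (x k) (\<rho> k *\<^sub>R proj_psd (- G (x k)))) \<longlonglongrightarrow> 0"
    using local_minimizer_penalty_sequence[OF assms] by blast
  then show "KKT f G xbar"
    using KKT_of_penalty_sequence[OF assms] CPLD by blast
qed (use KKT_of_penalty_sequence[OF assms] in blast)

end
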